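(* Let $\alpha,\beta>0$, $\rho:=\log_2(\alpha+\beta)$ and $\chi_k:=\frac{2k\pi}{\log 2}i$ for $k\in\mathbb{Z}$. Let $f(n)$ satisfy $f(n)=\alpha f(\lfloor n/2\rfloor)+\beta f(\lceil n/2\rceil)+g(n)$ for $n\ge2$, with $f(1)$ and $g(n)$ ($n\ge2$) given, and set $g(1):=0$. Let $\varphi$ be the unique continuous function on $[0,1]$ with $\varphi(0)=0$, $\varphi(1)=1$ and $\varphi(t)=\frac{\beta}{\alpha+\beta}\varphi(2t)$ for $t\in[0,\frac12]$, $\varphi(t)=\frac{\alpha}{\alpha+\beta}\varphi(2t-1)+\frac{\beta}{\alpha+\beta}$ for $t\in[\frac12,1]$. Extend $f$ and $g$ to real $x\ge1$ by $f(n+t):=f(n)+\varphi(t)(f(n+1)-f(n))$, $g(n+t):=g(n)+\varphi(t)(g(n+1)-g(n))$ ($n\ge1$, $0\le t\le1$), and set $g(x):=0$ for $x\in[0,1)$. Let $P_0(t):=\bigl(1+(\alpha+\beta-1)\varphi(2^{\{t\}}-1)\bigr)(\alpha+\beta)^{-\{t\}}$. \begin{enumerate} \item[(a)] If the sum $Q(x):=\sum_{m\ge1}2^{-\rho m}g(2^mx)$ converges uniformly for $x\in[1,2]$, then $f(x)=x^\rho P(\log_2x)-Q(x)$ for $x\ge1$, with $Q(x)=o(x^\rho)$, where $P(t)=\sum_{m\in\mathbb{Z}}2^{-\rho(m+t)}g(2^{m+t})+f(1)P_0(t)$ is a continuous $1$-periodic function, and the Fourier coefficients $\widehat{P}(k):=\int_0^1P(t)e^{-2k\pi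 it}\,dt$ of $P(t)$ are given by \begin{equation*} \widehat{P}(k) =\frac{1}{\log 2}\int_{1}^{\infty } \frac{g(u)}{u^{\rho + \chi_{k}+1}}\,du +\frac{f(1)}{\log 2}\int_{0}^{1} \frac{1+(\alpha +\beta -1)\varphi(u)} {(1+u)^{\rho +\chi_{k}+1}}\,du, \end{equation*} where the first integral is (at least) conditionally convergent. \item[(b)] If $\sum_{m\ge0}2^{-\rho m}A_m<\infty$, where $A_m:=\max_{2^m\le n\le 2^{m+1}}|g(n)|$, then the formula for $\widehat{P}(k)$ in (a) holds, with absolutely convergent integrals. \item[(c)] If $\alpha+\beta>1$ and $\sum_{m\ge0}2^{(1-\rho)m}B_m<\infty$, where $B_m:=\max_{2^m\le n<2^{m+1}}|g(n+1)-g(n)|$, then $P(t)$ has an absolutely convergent Fourier series $P(t)=\sum_{k\in\mathbb{Z}}\widehat{P}(k)e^{2\pi ikt}$ for $t\in\mathbb{R}$, where the coefficients are given by the formula in (a), with absolutely convergent integrals. \end{enumerate}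
   Context: Throughout, $\alpha,\beta>0$, $\{t\}$ denotes the fractional part of $t$, and the periodic function $P$ is the one in the identity $f(n)=n^\rho P(\log_2 n)-Q(n)$ obtained under the uniform convergence condition on $Q$. *)

theory Defs
  imports "HOL-Analysis.Analysis" "HOL-Library.Landau_Symbols"
begin

definition rho :: "real \<Rightarrow> real \<Rightarrow> real" where
  "rho \<alpha> \<beta> = log 2 (\<alpha> + \<beta>)"

definition chi :: "int \<Rightarrow> complex" where
  "chi k = 2 * of_int k * of_real pi / of_real (ln 2) * \<i>"

text \<open>Only the values of \<open>\<phi>\<close> on the unit interval are constrained; there they are
  determined uniquely by \<open>\<alpha>\<close> and \<open>\<beta>\<close>.\<close>

definition interpolant :: "real \<Rightarrow> real \<Rightarrow> (real \<Rightarrow> real) \<Rightarrow> bool" where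
  "interpolant \<alpha> \<beta> \<phi> \<longleftrightarrow>
     continuous_on {0..1} \<phi> \<and> \<phi> 0 = 0 \<and> \<phi> 1 = 1 \<and>
     (\<forall>t\<in>{0..1/2}. \<phi> t = \<beta> / (\<alpha> + \<beta>) * \<phi> (2 * t)) \<and>
     (\<forall>t\<in>{1/2..1}. \<phi> t = \<alpha> / (\<alpha> + \<beta>) * \<phi> (2 * t - 1) + \<beta> / (\<alpha> + \<beta>))"

text \<open>The value at \<open>n + t\<close> with \<open>n \<ge> 1\<close> is \<open>a n + \<phi> t * (a (n + 1) - a n)\<close> for all
  \<open>t \<in> {0..1}\<close>; the choice \<open>t = 1\<close> agrees with the floor convention because
  \<open>\<phi> 0 = 0\<close> and \<open>\<phi> 1 = 1\<close>. Meant for arguments \<open>x \<ge> 1\<close>.\<close>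

definition extend :: "(real \<Rightarrow> real) \<Rightarrow> (nat \<Rightarrow> real) \<Rightarrow> real \<Rightarrow> real" where
  "extend \<phi> a x =
     (let n = nat \<lfloor>x\<rfloor> in a n + \<phi> (x - real n) * (a (n + 1) - a n))"

definition extend0 :: "(real \<Rightarrow> real) \<Rightarrow> (nat \<Rightarrow> real) \<Rightarrow> real \<Rightarrow> real" where
  "extend0 \<phi> a x = (if x < 1 then 0 else extend \<phi> a x)"

definition P0 :: "real \<Rightarrow> real \<Rightarrow> (real \<Rightarrow> real) \<Rightarrow> real \<Rightarrow> real" where
  "P0 \<alpha> \<beta> \<phi> t =
     (1 + (\<alpha> + \<beta> - 1) * \<phi> (2 powr frac t - 1)) * (\<alpha> + \<beta>) powr (- frac t)"

definition Q_term :: "real \<Rightarrow> real \<Rightarrow> (real \<Rightarrow> real) \<Rightarrow> (nat \<Rightarrow> real) \<Rightarrow> nat \<Rightarrow> real \<Rightarrow> real" where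
  "Q_term \<alpha> \<beta> \<phi> g m x = 2 powr (- rho \<alpha> \<beta> * real m) * extend0 \<phi> g (2 ^ m * x)"

definition Q_fun :: "real \<Rightarrow> real \<Rightarrow> (real \<Rightarrow> real) \<Rightarrow> (nat \<Rightarrow> real) \<Rightarrow> real \<Rightarrow> real" where
  "Q_fun \<alpha> \<beta> \<phi> g x = (\<Sum>m. Q_term \<alpha> \<beta> \<phi> g (Suc m) x)"

definition Q_uniformly_convergent ::
    "real \<Rightarrow> real \<Rightarrow> (real \<Rightarrow> real) \<Rightarrow> (nat \<Rightarrow> real) \<Rightarrow> bool" where
  "Q_uniformly_convergent \<alpha> \<beta> \<phi> g \<longleftrightarrow>
     uniformly_convergent_on {1..2} (\<lambda>N x. \<Sum>m=1..N. Q_term \<alpha> \<beta> \<phi> g m x)"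

text \<open>Two-sided series, convergent when both halves are. Unordered summation
  (\<open>infsum\<close>) would be too strong, since the series for \<open>P\<close> may converge only
  conditionally.\<close>

definition int_summable :: "(int \<Rightarrow> real) \<Rightarrow> bool" where
  "int_summable h \<longleftrightarrow> summable (\<lambda>n. h (int n)) \<and> summable (\<lambda>n. h (- int (Suc n)))"

definition int_suminf :: "(int \<Rightarrow> real) \<Rightarrow> real" where
  "int_suminf h = (\<Sum>n. h (int n)) + (\<Sum>n. h (- int (Suc n)))"

definition P_term :: "real \<Rightarrow> real \<Rightarrow> (real \<Rightarrow> real) \<Rightarrow> (nat \<Rightarrow> real) \<Rightarrow> real \<Rightarrow> int \<Rightarrow> real" where
  "P_term \<alpha> \<beta> \<phi> g t m =
     2 powr (- rho \<alpha> \<beta> * (of_int m + t)) * extend0 \<phi> g (2 powr (of_int m + t))"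

definition P_fun ::
    "real \<Rightarrow> real \<Rightarrow> (real \<Rightarrow> real) \<Rightarrow> (nat \<Rightarrow> real) \<Rightarrow> (nat \<Rightarrow> real) \<Rightarrow> real \<Rightarrow> real" where
  "P_fun \<alpha> \<beta> \<phi> f g t = int_suminf (P_term \<alpha> \<beta> \<phi> g t) + f 1 * P0 \<alpha> \<beta> \<phi> t"

definition fourier_coeff :: "(real \<Rightarrow> real) \<Rightarrow> int \<Rightarrow> complex" where
  "fourier_coeff p k =
     integral {0..1} (\<lambda>t. of_real (p t) * exp (- 2 * of_int k * of_real pi * \<i> * of_real t))"

definition integrand1 ::
    "real \<Rightarrow> real \<Rightarrow> (real \<Rightarrow> real) \<Rightarrow> (nat \<Rightarrow> real) \<Rightarrow> int \<Rightarrow> real \<Rightarrow> complex" where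
  "integrand1 \<alpha> \<beta> \<phi> g k u =
     of_real (extend0 \<phi> g u) / of_real u powr (of_real (rho \<alpha> \<beta>) + chi k + 1)"

definition integrand2 :: "real \<Rightarrow> real \<Rightarrow> (real \<Rightarrow> real) \<Rightarrow> int \<Rightarrow> real \<Rightarrow> complex" where
  "integrand2 \<alpha> \<beta> \<phi> k u =
     of_real (1 + (\<alpha> + \<beta> - 1) * \<phi> u) / of_real (1 + u) powr (of_real (rho \<alpha> \<beta>) + chi k + 1)"

definition has_improper_integral :: "(real \<Rightarrow> complex) \<Rightarrow> complex \<Rightarrow> real \<Rightarrow> bool" where
  "has_improper_integral h I a \<longleftrightarrow>
     (\<forall>T\<ge>a. h integrable_on {a..T}) \<and> ((\<lambda>T. integral {a..T} h) \<longlongrightarrow> I) at_top"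

definition A_max :: "(nat \<Rightarrow> real) \<Rightarrow> nat \<Rightarrow> real" where
  "A_max g m = Max ((\<lambda>n. \<bar>g n\<bar>) ` {2 ^ m..2 ^ (m + 1)})"

definition B_max :: "(nat \<Rightarrow> real) \<Rightarrow> nat \<Rightarrow> real" where
  "B_max g m = Max ((\<lambda>n. \<bar>g (n + 1) - g n\<bar>) ` {2 ^ m..<2 ^ (m + 1)})"

end

theory Submission imports Defs begin

text \<open>
  Since \<open>\<phi>\<close> is the interpolant adapted to the weights, the recurrence extends to real arguments as
  \<open>f (2 x) = (\<alpha> + \<beta>) f x + g (2 x)\<close>. On the logarithmic scale, with \<open>h t = 2 powr (- \<rho> t) f (2 powr t)\<close>
  and \<open>p t = 2 powr (- \<rho> t) g (2 powr t)\<close>, this is \<open>h (t + 1) = h t + p (t + 1)\<close>, so adding the tail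
  \<open>S (t + 1)\<close> of \<open>S t = p t + p (t + 1) + \<dots>\<close> to \<open>h t\<close> gives a \<open>1\<close>-periodic function \<open>P\<close>. Integrating the
  uniformly convergent series for \<open>P\<close> over a period unfolds to an integral of \<open>p\<close> over the half line.

  In (c), \<open>\<phi>\<close> is nondecreasing with a geometric modulus of continuity. Replacing \<open>g\<close> and \<open>f\<close> by their
  variations dominates the increments of \<open>P\<close> by those of a monotone function with a geometric modulus
  of continuity. Zygmund's theorem (bounded variation together with Hoelder continuity) then gives
  absolute convergence of the Fourier series, and uniqueness of Fourier coefficients identifies its sum.
\<close>

section \<open>Fourier series of continuous periodic functions\<close>

text \<open>Two obstacles shape the argument. In (a) the series for \<open>P\<close> may converge
  only conditionally, so limits and integrals are exchanged by uniform convergence alone, and real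
  upper limits of integration are reached from integer ones because \<open>p\<close> tends to 0. In
  (c) the dilation \<open>2 ^ m * x\<close> magnifies the distance of two arguments, so an interval
  of length \<open>1 / 2 ^ j\<close> is either long (its unit cells are counted) or short (it meets
  at most two cells and the modulus of \<phi> applies). The larger weight \<open>q\<close> is at
  least 1/2, and this lets the single bound \<open>2 ^ m * q ^ j\<close> serve both regimes; the
  hypothesis on \<open>B_max\<close> is what makes the resulting bounds summable in
  \<open>m\<close>.

  The origin of \<open>P0\<close>: on the first dyadic interval the interpolated f involves only
  \<open>f 1\<close> and \<open>f 2\<close>, and \<open>f 2\<close> is
  \<open>(\<alpha> + \<beta>) * f 1 + g 2\<close>; \<open>P0\<close> is the normalised contribution
  of \<open>f 1\<close>.

  The hypothesis of (c) implies that of (b), which implies that of (a). The locales are included in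
  one another accordingly, so that the coefficient formula is inherited.\<close>

definition character :: "int \<Rightarrow> real \<Rightarrow> complex" where
  "character k t = cis (2 * pi * of_int k * t)"

definition coefficient :: "(real \<Rightarrow> complex) \<Rightarrow> int \<Rightarrow> complex" where
  "coefficient D k = integral {0..1} (\<lambda>t. D t * character (- k) t)"

lemma continuous_on_character [continuous_intros]:
  "continuous_on A u \<Longrightarrow> continuous_on A (\<lambda>x. character k (u x))"
  unfolding character_def cis_conv_exp by (intro continuous_intros)

lemma norm_character [simp]: "norm (character k t) = 1"
  by (simp add: character_def)

lemma character_0 [simp]: "character 0 t = 1"
  by (simp add: character_def)

lemma character_at_0 [simp]: "character k 0 = 1"
  by (simp add: character_def)

lemma character_mult: "character k t * character l t = character (k + l) t"
  by (simp add: character_def cis_mult algebra_simps)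

lemma character_add: "character k (s + t) = character k s * character k t"
  by (simp add: character_def cis_mult algebra_simps)

lemma character_of_int [simp]: "character k (of_int n) = 1"
proof -
  have "character k (of_int n) = cis (2 * pi * of_int (k * n))"
    by (simp add: character_def mult.assoc)
  then show ?thesis using cis_multiple_2pi[of "of_int (k * n)"] by simp
qed

lemma character_at_1 [simp]: "character k 1 = 1"
  using character_of_int[of k 1] by simp

lemma character_periodic [simp]: "character k (t + 1) = character k t"
  by (simp add: character_add)

lemma cnj_character: "cnj (character k t) = character (- k) t"
  by (simp add: character_def cis_cnj)

lemma character_nonzero [simp]: "character k t \<noteq> 0"
  by (metis norm_character norm_zero zero_neq_one)

lemma character_inverse: "character (- k) t = 1 / character k t"
  using character_mult[of "- k" t k] by (simp add: eq_divide_eq)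

lemma has_integral_character:
  "(character k has_integral (if k = 0 then 1 else 0)) {0..1}"
proof (cases "k = 0")
  case True
  then have "character k = (\<lambda>_. 1)" by (simp add: fun_eq_iff)
  then show ?thesis using True has_integral_const_real[of "1::complex" 0 1] by simp
next
  case False
  define c :: complex where "c = 2 * pi * of_int k * \<i>"
  have c: "c \<noteq> 0" using False by (simp add: c_def)
  have ch: "character k t = exp (of_real t * c)" for t
    by (simp add: character_def cis_conv_exp c_def algebra_simps)
  have "((\<lambda>t. exp (of_real t * c)) has_integral
      (exp (of_real 1 * c) / c - exp (of_real 0 * c) / c)) {0..1}"
  proof (rule fundamental_theorem_of_calculus)
    fix t :: real
    have "((\<lambda>z. exp (z * c) / c) has_field_derivative exp (of_real t * c)) (at (of_real t))"
      using c by (auto intro!: derivative_eq_intros)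
    then show "((\<lambda>t. exp (of_real t * c) / c) has_vector_derivative exp (of_real t * c)) (at t within {0..1})"
      by (rule has_vector_derivative_real_field)
  qed simp
  moreover have "exp (of_real 1 * c) = 1" "exp (of_real 0 * c) = 1"
    using ch[of 1] ch[of 0] by simp_all
  moreover have "character k = (\<lambda>t. exp (of_real t * c))" by (simp add: fun_eq_iff ch)
  ultimately show ?thesis using False by simp
qed

text \<open>Let \<open>T\<close> be the Fourier polynomial of \<open>D\<close> with frequencies in
  \<open>K\<close>. By orthogonality the integrals of \<open>D t * cnj (T t)\<close> and of
  \<open>T t * cnj (T t)\<close> both equal \<open>S\<close>, so the nonnegative integral of
  \<open>(cmod (D t - T t))\<close> squared collapses to the right side minus the left.\<close>

lemma bessel_inequality:
  assumes D: "continuous_on {0..1} D" and K: "finite K"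
  shows "(\<Sum>k\<in>K. (cmod (coefficient D k))\<^sup>2) \<le> integral {0..1} (\<lambda>t. (cmod (D t))\<^sup>2)"
proof -
  define c where "c = coefficient D"
  define T where "T t = (\<Sum>k\<in>K. c k * character k t)" for t
  define S :: complex where "S = (\<Sum>k\<in>K. of_real ((cmod (c k))\<^sup>2))"
  have cT: "continuous_on {0..1} T"
    unfolding T_def by (intro continuous_intros)
  have DI: "((\<lambda>t. D t * character (- k) t) has_integral c k) {0..1}" for k
    unfolding c_def coefficient_def
    by (intro integrable_integral integrable_continuous_real continuous_intros D)
  have cnjT: "cnj (T t) = (\<Sum>k\<in>K. cnj (c k) * character (- k) t)" for t
    by (simp add: T_def cnj_character)
  have "((\<lambda>t. \<Sum>k\<in>K. cnj (c k) * (D t * character (- k) t)) has_integral (\<Sum>k\<in>K. cnj (c k) * c k)) {0..1}"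
    by (intro has_integral_sum K has_integral_mult_right DI)
  moreover have "(\<Sum>k\<in>K. cnj (c k) * c k) = S"
    by (simp add: S_def complex_norm_square mult.commute del: of_real_power)
  ultimately have I1: "((\<lambda>t. D t * cnj (T t)) has_integral S) {0..1}"
    by (simp add: cnjT sum_distrib_left mult_ac)
  have "((\<lambda>t. \<Sum>k\<in>K. \<Sum>l\<in>K. c k * cnj (c l) * character (k - l) t) has_integral
        (\<Sum>k\<in>K. \<Sum>l\<in>K. c k * cnj (c l) * (if k - l = 0 then 1 else 0))) {0..1}"
    by (intro has_integral_sum K has_integral_mult_right has_integral_character)
  moreover have "(\<Sum>k\<in>K. \<Sum>l\<in>K. c k * cnj (c l) * (if k - l = 0 then 1 else 0)) = S"
    using K by (simp add: S_def if_distrib complex_norm_square del: of_real_power cong: if_cong)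
  moreover have "T t * cnj (T t) = (\<Sum>k\<in>K. \<Sum>l\<in>K. c k * cnj (c l) * character (k - l) t)" for t
  proof -
    have "T t * cnj (T t) = (\<Sum>k\<in>K. \<Sum>l\<in>K. (c k * character k t) * (cnj (c l) * character (- l) t))"
      unfolding cnjT unfolding T_def by (simp add: sum_product)
    also have "\<dots> = (\<Sum>k\<in>K. \<Sum>l\<in>K. c k * cnj (c l) * character (k - l) t)"
      by (intro sum.cong refl) (metis (no_types, lifting) character_mult mult.assoc mult.left_commute uminus_add_conv_diff add.commute)
    finally show ?thesis .
  qed
  ultimately have I2: "((\<lambda>t. T t * cnj (T t)) has_integral S) {0..1}"
    by simp
  have sq: "((\<lambda>t. (cmod (D t))\<^sup>2) has_integral integral {0..1} (\<lambda>t. (cmod (D t))\<^sup>2)) {0..1}"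
    by (intro integrable_integral integrable_continuous_real continuous_intros D)
  have "((\<lambda>t. (cmod (D t))\<^sup>2 - 2 * Re (D t * cnj (T t)) + Re (T t * cnj (T t))) has_integral
      (integral {0..1} (\<lambda>t. (cmod (D t))\<^sup>2) - 2 * Re S + Re S)) {0..1}"
    by (intro has_integral_add has_integral_diff has_integral_mult_right has_integral_Re sq I1 I2)
  moreover have "(cmod (D t))\<^sup>2 - 2 * Re (D t * cnj (T t)) + Re (T t * cnj (T t)) = (cmod (D t - T t))\<^sup>2" for t
    unfolding cmod_power2 by (simp add: power2_eq_square algebra_simps)
  ultimately have "((\<lambda>t. (cmod (D t - T t))\<^sup>2) has_integral
      (integral {0..1} (\<lambda>t. (cmod (D t))\<^sup>2) - 2 * Re S + Re S)) {0..1}" by simp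
  then have "0 \<le> integral {0..1} (\<lambda>t. (cmod (D t))\<^sup>2) - 2 * Re S + Re S"
    by (rule has_integral_nonneg) simp
  moreover have "Re S = (\<Sum>k\<in>K. (cmod (c k))\<^sup>2)"
    unfolding S_def by (simp del: of_real_power)
  ultimately show ?thesis by (simp add: c_def)
qed

section \<open>Translation of periodic functions and uniqueness of Fourier coefficients\<close>

lemma periodic_of_int:
  fixes p :: "real \<Rightarrow> 'a"
  assumes "\<And>t. p (t + 1) = p t"
  shows "p (t + of_int n) = p t"
proof (induction n rule: int_induct[where k = 0])
  case (step1 i)
  then show ?case using assms[of "t + of_int i"] by (simp add: add.assoc)
next
  case (step2 i)
  then show ?case using assms[of "t + of_int i - 1"] by (simp add: algebra_simps)
qed simp

text \<open>The translated window \<open>{a..1 + a}\<close> is cut at 1, and the part beyond 1 is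
  moved back by one period.\<close>

lemma integral_periodic_shift:
  fixes p :: "real \<Rightarrow> 'a::euclidean_space"
  assumes "continuous_on UNIV p" and per: "\<And>t. p (t + 1) = p t" and a: "0 \<le> a" "a \<le> 1"
  shows "integral {0..1} (\<lambda>t. p (t + a)) = integral {0..1} p"
proof -
  have c: "continuous_on A p" for A
    using assms(1) continuous_on_subset by blast
  have "integral {0..1} (\<lambda>t. p (t + a)) = integral {0 + a..1 + a} p"
    using integral_shift[of 0 a 1 p] c by (simp add: o_def)
  also have "\<dots> = integral {a..1} p + integral {1..1 + a} p"
    using a by (simp add: Henstock_Kurzweil_Integration.integral_combine integrable_continuous_real c)
  also have "integral {1..1 + a} p = integral {0..a} p"
    using integral_shift[of 0 1 a p] c per by (simp add: o_def add.commute)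
  also have "integral {a..1} p + integral {0..a} p = integral {0..1} p"
    using a by (simp add: Henstock_Kurzweil_Integration.integral_combine integrable_continuous_real c
        add.commute)
  finally show ?thesis .
qed

text \<open>Used twice: a translation keeps vanishing coefficients at zero, and a difference
  \<open>D (t + h) - D t\<close> has the coefficients of \<open>D\<close> multiplied by
  \<open>character k h - 1\<close>.\<close>

lemma coefficient_shift:
  assumes "continuous_on UNIV D" and "\<And>t. D (t + 1) = D t" and "0 \<le> a" "a \<le> 1"
  shows "coefficient (\<lambda>t. D (t + a)) k = character k a * coefficient D k"
proof -
  have "integral {0..1} (\<lambda>t. D (t + a) * character (- k) (t + a)) = coefficient D k"
    unfolding coefficient_def
    by (rule integral_periodic_shift[of "\<lambda>t. D t * character (- k) t"])
       (use assms in \<open>auto intro!: continuous_intros\<close>)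
  moreover have "(\<lambda>t. D (t + a) * character (- k) t)
      = (\<lambda>t. character k a * (D (t + a) * character (- k) (t + a)))"
    by (auto simp: character_add fun_eq_iff) (metis character_0 character_mult mult.commute mult.assoc mult.left_commute mult_1 add.left_inverse)
  ultimately show ?thesis unfolding coefficient_def by simp
qed

text \<open>The kernel \<open>cos (\<pi> t) ^ (2 n)\<close> is a trigonometric polynomial that concentrates at the
  integers as \<open>n\<close> grows.\<close>

lemma continuous_zero_coefficients_at_0:
  assumes cont: "continuous_on UNIV D" and per: "\<And>t. D (t + 1) = D t"
    and zero: "\<And>k. coefficient D k = 0"
  shows "D 0 = 0"
proof (rule ccontr)
  assume "D 0 \<noteq> 0"
  define d where "d = D 0"
  define K :: "nat \<Rightarrow> real \<Rightarrow> real" where "K n t = ((cos (pi * t))\<^sup>2) ^ n" for n t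
  have d: "cmod d > 0" using \<open>D 0 \<noteq> 0\<close> by (simp add: d_def)
  have c: "continuous_on A D" for A
    using cont continuous_on_subset by blast
  have cK [continuous_intros]: "continuous_on A (K n)" for A n
    unfolding K_def by (intro continuous_intros)
  have cos2: "complex_of_real ((cos (pi * t))\<^sup>2) = 1/2 + character 1 t / 4 + character (-1) t / 4" for t
    using cos_double_cos[of "pi * t"]
    by (auto simp: character_def complex_eq_iff mult_ac diff_divide_distrib)
  \<comment> \<open>Each further factor of the kernel moves the frequency by -1, 0 or 1, so the
    induction has to carry an arbitrary character.\<close>
  have K0: "((\<lambda>t. D t * character k t * of_real (K n t)) has_integral 0) {0..1}" for n k
  proof (induction n arbitrary: k)
    case 0
    have "((\<lambda>t. D t * character (- (- k)) t) has_integral coefficient D (- k)) {0..1}"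
      unfolding coefficient_def
      by (intro integrable_integral integrable_continuous_real continuous_intros c)
    then show ?case using zero by (simp add: K_def)
  next
    case (Suc n)
    have "((\<lambda>t. 1/2 * (D t * character k t * of_real (K n t)) + 1/4 * (D t * character (k + 1) t * of_real (K n t))
        + 1/4 * (D t * character (k + -1) t * of_real (K n t))) has_integral (1/2 * 0 + 1/4 * 0 + 1/4 * 0)) {0..1}"
      by (intro has_integral_add has_integral_mult_right Suc)
    moreover have "1/2 * (D t * character k t * of_real (K n t)) + 1/4 * (D t * character (k + 1) t * of_real (K n t))
        + 1/4 * (D t * character (k + -1) t * of_real (K n t)) = D t * character k t * of_real (K (Suc n) t)" for t
    proof -
      have "complex_of_real (K (Suc n) t) = (1/2 + character 1 t / 4 + character (-1) t / 4) * of_real (K n t)"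
        unfolding K_def power_Suc of_real_mult cos2 by simp
      then show ?thesis by (simp add: character_mult[symmetric] algebra_simps flip: add_uminus_conv_diff)
    qed
    ultimately show ?case by simp
  qed
  define I where "I n = integral {0..1} (K n)" for n
  have KI: "(K n has_integral I n) {0..1}" for n
    unfolding I_def by (intro integrable_integral integrable_continuous_real continuous_intros)
  obtain M where M: "\<And>t. t \<in> {0..1} \<Longrightarrow> cmod (d - D t) \<le> M"
  proof -
    have "compact ((\<lambda>t. d - D t) ` {0..1})"
      by (intro compact_continuous_image continuous_intros c) auto
    then show ?thesis using that compact_imp_bounded bounded_iff by (metis imageI)
  qed
  have M0: "M \<ge> 0" using M[of 0] order_trans[OF norm_ge_zero] by simp
  have "\<exists>\<delta>>0. \<forall>t. dist t 0 < \<delta> \<longrightarrow> dist (D t) (D 0) < cmod d / 2"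
    using cont half_gt_zero[OF d] unfolding continuous_on_iff by blast
  then obtain \<delta>' where \<delta>': "\<delta>' > 0" "\<And>t. \<bar>t\<bar> < \<delta>' \<Longrightarrow> cmod (d - D t) < cmod d / 2"
    by (auto simp: d_def dist_norm norm_minus_commute)
  define \<delta> where "\<delta> = min \<delta>' (1/2)"
  have \<delta>: "0 < \<delta>" "\<delta> \<le> 1/2" "\<And>t. \<bar>t\<bar> < \<delta> \<Longrightarrow> cmod (d - D t) < cmod d / 2"
    using \<delta>' by (auto simp: \<delta>_def)
  \<comment> \<open>Two radii are needed. \<open>r\<close> bounds the squared cosine at distance at
    least \<delta> from the integers, and \<open>r'\<close> bounds it from below on
    \<open>{0..\<delta>/2}\<close>. As \<open>r < r'\<close>, the mass of the kernel near 0
    eventually exceeds any multiple of \<open>r ^ n\<close>. The choice \<delta> \<le> 1/2 keeps the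
    cosine nonnegative.\<close>
  define r where "r = (cos (pi * \<delta>))\<^sup>2"
  define r' where "r' = (cos (pi * (\<delta> / 2)))\<^sup>2"
  have pi\<delta>: "0 < pi * \<delta>" "pi * \<delta> \<le> pi / 2" using \<delta> by auto
  have cosnn: "0 \<le> cos (pi * \<delta>)"
    using pi\<delta> pi_gt_zero by (intro cos_ge_zero) linarith+
  have cosless: "cos (pi * \<delta>) < cos (pi * (\<delta> / 2))"
    using pi\<delta> pi_gt_zero by (intro cos_monotone_0_pi) linarith+
  have rr': "0 \<le> r" "r < r'"
    using cosnn cosless by (auto simp: r_def r'_def intro!: power_strict_mono)
  have near: "cmod (d - D t) * K n t \<le> cmod d / 2 * K n t + M * r ^ n" if t: "t \<in> {0..1}" for t n
  proof -
    have K0: "0 \<le> K n t" by (simp add: K_def)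
    consider "t < \<delta>" | "t > 1 - \<delta>" | "\<delta> \<le> t" "t \<le> 1 - \<delta>" by linarith
    then show ?thesis
    proof cases
      case 1
      then have "cmod (d - D t) \<le> cmod d / 2" using t \<delta>(3)[of t] by simp
      then show ?thesis using K0 M0 rr' by (intro add_increasing2 mult_right_mono) auto
    next
      case 2
      then have "cmod (d - D (t - 1)) \<le> cmod d / 2" using t \<delta>(3)[of "t - 1"] by simp
      then show ?thesis using per[of "t - 1"] K0 M0 rr' by (intro add_increasing2 mult_right_mono) auto
    next
      case 3
      have "\<bar>cos (pi * t)\<bar> \<le> cos (pi * \<delta>)"
      proof (rule abs_leI)
        show "cos (pi * t) \<le> cos (pi * \<delta>)"
          using 3 \<delta> t by (intro cos_monotone_0_pi_le) auto
        have "- cos (pi * t) = cos (pi * (1 - t))" by (simp add: algebra_simps cos_diff)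
        also have "\<dots> \<le> cos (pi * \<delta>)"
          using 3 \<delta> t by (intro cos_monotone_0_pi_le) auto
        finally show "- cos (pi * t) \<le> cos (pi * \<delta>)" .
      qed
      then have "(cos (pi * t))\<^sup>2 \<le> r" unfolding r_def
        by (metis abs_le_square_iff abs_of_nonneg cosnn)
      then have "K n t \<le> r ^ n" unfolding K_def by (intro power_mono) auto
      then have "cmod (d - D t) * K n t \<le> M * r ^ n"
        using M[OF t] K0 M0 by (intro mult_mono) auto
      then show ?thesis using K0 d by (simp add: add_increasing)
    qed
  qed
  have Knn: "0 \<le> K n t" for n t by (simp add: K_def)
  \<comment> \<open>The kernel integrates to zero against \<open>D\<close>, so
    \<open>d * I n\<close> is the integral of \<open>(d - D t) * K n t\<close>. The estimate
    \<open>near\<close> bounds this by half of \<open>cmod d * I n\<close> plus an error, and the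
    half is absorbed on the left.\<close>
  have bound: "cmod d / 2 * I n \<le> M * r ^ n" for n
  proof -
    have "((\<lambda>t. d * of_real (K n t) - D t * character 0 t * of_real (K n t)) has_integral (d * of_real (I n) - 0)) {0..1}"
      using KI[of n] by (intro has_integral_diff K0 has_integral_mult_right) (simp add: has_integral_of_real)
    then have *: "((\<lambda>t. (d - D t) * of_real (K n t)) has_integral (d * of_real (I n))) {0..1}"
      by (simp add: algebra_simps)
    have **: "((\<lambda>t. cmod d / 2 * K n t + M * r ^ n) has_integral (cmod d / 2 * I n + M * r ^ n)) {0..1}"
      using has_integral_add[OF has_integral_mult_right[OF KI[of n], of "cmod d / 2"]
          has_integral_const_real[of "M * r ^ n" 0 1]] by simp
    have "cmod (d * of_real (I n)) \<le> cmod d / 2 * I n + M * r ^ n"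
      unfolding integral_unique[OF *, symmetric] integral_unique[OF **, symmetric]
      by (intro integral_norm_bound_integral has_integral_integrable[OF *] has_integral_integrable[OF **])
         (use near Knn in \<open>auto simp: norm_mult\<close>)
    moreover have "I n \<ge> 0" using KI[of n] by (rule has_integral_nonneg) (auto simp: K_def)
    ultimately show ?thesis by (simp add: norm_mult)
  qed
  have lower: "\<delta> / 2 * r' ^ n \<le> I n" for n
  proof -
    have "((\<lambda>t. r' ^ n) has_integral (\<delta> / 2 * r' ^ n)) {0..\<delta>/2}"
      using has_integral_const_real[of "r' ^ n" 0 "\<delta>/2"] \<delta> by simp
    moreover have Ki: "(K n has_integral integral {0..\<delta>/2} (K n)) {0..\<delta>/2}"
      by (intro integrable_integral integrable_continuous_real continuous_intros)
    ultimately have "\<delta> / 2 * r' ^ n \<le> integral {0..\<delta>/2} (K n)"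
    proof (rule has_integral_le)
      fix t assume t: "t \<in> {0..\<delta>/2}"
      have "cos (pi * (\<delta> / 2)) \<le> cos (pi * t)"
        using t \<delta> by (intro cos_monotone_0_pi_le) (auto simp: field_simps)
      then show "r' ^ n \<le> K n t"
        unfolding r'_def K_def using cosnn cosless by (intro power_mono) auto
    qed
    also have "\<dots> \<le> I n"
      by (rule has_integral_subset_le[OF _ Ki KI]) (use \<delta> in \<open>auto simp: K_def\<close>)
    finally show ?thesis .
  qed
  define C where "C = M / (cmod d / 2) / (\<delta> / 2)"
  have C: "r' ^ n \<le> C * r ^ n" for n
  proof -
    have "I n \<le> M / (cmod d / 2) * r ^ n" using bound[of n] d by (simp add: field_simps)
    then have "\<delta> / 2 * r' ^ n \<le> M / (cmod d / 2) * r ^ n" using lower[of n] by linarith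
    then show ?thesis using \<delta>(1) d by (simp add: C_def field_simps)
  qed
  have "(\<lambda>n. C * (r / r') ^ n) \<longlonglongrightarrow> C * 0"
    using rr' by (intro tendsto_mult tendsto_const LIMSEQ_power_zero) simp
  then have "eventually (\<lambda>n. C * (r / r') ^ n < 1) sequentially"
    by (simp add: order_tendstoD)
  then obtain n where "C * (r / r') ^ n < 1" by (auto simp: eventually_sequentially)
  moreover have "r' ^ n > 0" using rr' by simp
  ultimately have "C * r ^ n < r' ^ n" by (simp add: power_divide divide_less_eq)
  then show False using C[of n] by simp
qed

text \<open>The value at \<open>t\<close> is moved to 0 by a translation. \<open>frac t\<close> is
  used as the shift because \<open>coefficient_shift\<close> is restricted to the unit
  interval.\<close>

lemma continuous_zero_coefficients:
  assumes cont: "continuous_on UNIV D" and per: "\<And>t. D (t + 1) = D t"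
    and zero: "\<And>k. coefficient D k = 0"
  shows "D t = 0"
proof -
  have "(\<lambda>s. D (s + frac t)) 0 = 0"
  proof (rule continuous_zero_coefficients_at_0)
    show "continuous_on UNIV (\<lambda>s. D (s + frac t))"
      by (intro continuous_on_compose2[OF cont] continuous_intros) auto
    show "D (s + 1 + frac t) = D (s + frac t)" for s
      using per[of "s + frac t"] by (simp add: algebra_simps)
    show "coefficient (\<lambda>s. D (s + frac t)) k = 0" for k
      using coefficient_shift[OF cont per, of "frac t" k] zero frac_lt_1[of t]
      by simp
  qed
  then show ?thesis using periodic_of_int[of D "frac t" "\<lfloor>t\<rfloor>", OF per] by (simp add: frac_def)
qed


text \<open>By the Weierstrass test the series has a continuous sum \<open>S\<close>, and termwise
  integration shows that \<open>S\<close> has the same coefficients as \<open>D\<close>. Uniqueness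
  is then applied to \<open>D - S\<close>.\<close>

lemma has_sum_fourier_series:
  assumes cont: "continuous_on UNIV D" and per: "\<And>t. D (t + 1) = D t"
    and summ: "(\<lambda>k. norm (coefficient D k)) summable_on UNIV"
  shows "((\<lambda>k. coefficient D k * character k t) has_sum D t) UNIV"
proof -
  define c where "c = coefficient D"
  define S where "S t = (\<Sum>\<^sub>\<infinity>k. c k * character k t)" for t
  have summ': "(\<lambda>k. norm (c k)) summable_on UNIV" using summ by (simp add: c_def)
  have sm: "(\<lambda>k. c k * character k t) summable_on UNIV" for t
    by (rule abs_summable_summable) (use summ' in \<open>simp add: norm_mult\<close>)
  have contS: "continuous_on UNIV S"
    unfolding S_def
    by (rule uniform_limit_theorem[OF _ Weierstrass_m_test_general[OF _ summ']])
       (auto simp: norm_mult intro!: always_eventually continuous_intros)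
  have coeffS: "coefficient S k = c k" for k
  proof -
    have "uniform_limit {0..1} (\<lambda>Y t. \<Sum>l\<in>Y. c l * character (l - k) t)
        (\<lambda>t. \<Sum>\<^sub>\<infinity>l. c l * character (l - k) t) (finite_subsets_at_top UNIV)"
      by (rule Weierstrass_m_test_general[OF _ summ']) (simp add: norm_mult)
    moreover have "(\<Sum>\<^sub>\<infinity>l. c l * character (l - k) t) = S t * character (- k) t" for t
    proof -
      have "(\<Sum>\<^sub>\<infinity>l. c l * character (l - k) t) = (\<Sum>\<^sub>\<infinity>l. c l * character l t * character (- k) t)"
        by (simp add: mult.assoc character_mult)
      also have "\<dots> = S t * character (- k) t"
        unfolding S_def using sm by (intro infsum_cmult_left) auto
      finally show ?thesis .
    qed
    ultimately have ul: "uniform_limit {0..1} (\<lambda>Y t. \<Sum>l\<in>Y. c l * character (l - k) t)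
        (\<lambda>t. S t * character (- k) t) (finite_subsets_at_top UNIV)" by simp
    obtain I J where I: "\<And>Y. ((\<lambda>t. \<Sum>l\<in>Y. c l * character (l - k) t) has_integral I Y) {0..1}"
      and J: "((\<lambda>t. S t * character (- k) t) has_integral J) {0..1}"
      and lim: "(I \<longlongrightarrow> J) (finite_subsets_at_top UNIV)"
      by (rule uniform_limit_integral[OF ul]) (auto intro!: continuous_intros)
    \<comment> \<open>Orthogonality makes the net of integrated partial sums constant as soon as the
      index set contains \<open>k\<close>.\<close>
    have "I Y = c k" if Y: "finite Y" "k \<in> Y" for Y
    proof -
      have "((\<lambda>t. \<Sum>l\<in>Y. c l * character (l - k) t) has_integral
          (\<Sum>l\<in>Y. c l * (if l - k = 0 then 1 else 0))) {0..1}"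
        by (intro has_integral_sum Y has_integral_mult_right has_integral_character)
      then have "I Y = (\<Sum>l\<in>Y. c l * (if l - k = 0 then 1 else 0))"
        using I has_integral_unique by blast
      also have "\<dots> = c k" using Y by (simp add: if_distrib cong: if_cong)
      finally show ?thesis .
    qed
    then have "eventually (\<lambda>Y. I Y = c k) (finite_subsets_at_top UNIV)"
      unfolding eventually_finite_subsets_at_top by (intro exI[of _ "{k}"]) auto
    then have "(I \<longlongrightarrow> c k) (finite_subsets_at_top UNIV)"
      by (rule tendsto_eventually)
    then have "J = c k" using lim tendsto_unique finite_subsets_at_top_neq_bot by blast
    then show ?thesis using J unfolding coefficient_def by (simp add: integral_unique)
  qed
  have "D t - S t = 0"
  proof (rule continuous_zero_coefficients[of "\<lambda>t. D t - S t"])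
    show "continuous_on UNIV (\<lambda>t. D t - S t)" by (intro continuous_intros cont contS)
    show "D (t + 1) - S (t + 1) = D t - S t" for t by (simp add: per S_def)
    show "coefficient (\<lambda>t. D t - S t) k = 0" for k
    proof -
      have "continuous_on {0..1} D" "continuous_on {0..1} S"
        using cont contS continuous_on_subset by blast+
      then have "coefficient (\<lambda>t. D t - S t) k = coefficient D k - coefficient S k"
        unfolding coefficient_def left_diff_distrib
        by (intro integral_diff integrable_continuous_real continuous_intros)
      then show ?thesis by (simp add: coeffS c_def)
    qed
  qed
  then show ?thesis using sm[of t] unfolding S_def c_def by (simp add: has_sum_iff)
qed

text \<open>Zygmund's theorem: bounded variation (domination of the increments by those of \<open>V\<close>) together
  with a geometric modulus of continuity. Bessel's inequality for \<open>D (t + h) - D t\<close> controls the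
  coefficients of index comparable to \<open>1 / h\<close>.\<close>

lemma summable_coefficients_if_bounded_variation:
  fixes D :: "real \<Rightarrow> complex" and V :: "real \<Rightarrow> real"
  assumes cont: "continuous_on UNIV D" and per: "\<And>t. D (t + 1) = D t"
    and dom: "\<And>s t. \<lbrakk>0 \<le> s; s \<le> t; t \<le> 2\<rbrakk> \<Longrightarrow> cmod (D t - D s) \<le> V t - V s"
    and modulus: "\<And>s t j. \<lbrakk>0 \<le> s; s \<le> t; t \<le> 2; t - s \<le> 1 / 2 ^ (j + 2)\<rbrakk> \<Longrightarrow> V t - V s \<le> C * q ^ j"
    and q: "0 \<le> q" "q < 1"
  shows "(\<lambda>k. norm (coefficient D k)) summable_on UNIV"
proof -
  define c where "c = coefficient D"
  define Z where "Z = V 2 - V 0"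
  have Vmono: "V s \<le> V t" if "0 \<le> s" "s \<le> t" "t \<le> 2" for s t
    using dom[OF that] norm_ge_zero[of "D t - D s"] by linarith
  have Z0: "Z \<ge> 0" using Vmono[of 0 2] by (simp add: Z_def)
  have C0: "C \<ge> 0" using modulus[of 0 0 0] by simp
  define block where "block j = {k::int. 2 ^ j \<le> \<bar>k\<bar> \<and> \<bar>k\<bar> < 2 ^ (j + 1)}" for j :: nat
  have fin: "finite (block j)" for j
    by (rule finite_subset[of _ "{- (2 ^ (j + 1))..2 ^ (j + 1)}"]) (auto simp: block_def)
  have blockbound: "(\<Sum>k\<in>block j. cmod (c k)) \<le> sqrt (C * Z) * sqrt q ^ j" for j
  proof -
    \<comment> \<open>With \<open>h = 1 / 2 ^ (j + 2)\<close> the angle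
      \<open>2 * pi * \<bar>k\<bar> * h\<close> lies between \<open>pi / 2\<close> and
      \<open>pi\<close> for every \<open>k\<close> in the block. Hence its cosine is nonpositive and
      the multiplier \<open>character k h - 1\<close> has squared modulus at least 2 on the whole
      block.\<close>
    define N :: nat where "N = 2 ^ (j + 2)"
    define h where "h = 1 / real N"
    have N0: "real N > 0" by (simp add: N_def)
    have "N \<ge> 1" by (simp add: N_def)
    then have h: "0 < h" "h \<le> 1" using N0 by (simp_all add: h_def field_simps)
    have h_eq: "h = 1 / 2 ^ (j + 2)" by (simp add: h_def N_def)
    have Nh: "real N * h = 1" using N0 by (simp add: h_def)
    define E where "E t = D (t + h) - D t" for t
    define J where "J = integral {0..1} (\<lambda>t. (cmod (E t))\<^sup>2)"
    have contE: "continuous_on A E" for A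
      unfolding E_def by (intro continuous_intros continuous_on_compose2[OF cont]) auto
    have perE: "E (t + 1) = E t" for t
      using per[of "t + h"] per[of t] by (simp add: E_def algebra_simps)
    \<comment> \<open>By periodicity all \<open>N\<close> translates of the squared increment have
      the same integral. Adding the translates before integrating lets a pointwise telescoping sum
      bound \<open>N * J\<close>.\<close>
    have J: "((\<lambda>t. (cmod (E (t + real i * h)))\<^sup>2) has_integral J) {0..1}" if "i < N" for i
    proof -
      have "real i * h \<le> real N * h" using that h by (intro mult_right_mono) auto
      then have "integral {0..1} (\<lambda>t. (cmod (E (t + real i * h)))\<^sup>2) = J"
        unfolding J_def using h Nh perE
        by (intro integral_periodic_shift[of "\<lambda>t. (cmod (E t))\<^sup>2"] continuous_intros contE) auto
      moreover have "(\<lambda>t. (cmod (E (t + real i * h)))\<^sup>2) integrable_on {0..1}"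
        by (intro integrable_continuous_real continuous_intros
            continuous_on_compose2[OF contE[of UNIV]]) auto
      ultimately show ?thesis by (simp add: has_integral_iff)
    qed
    have sumJ: "((\<lambda>t. \<Sum>i<N. (cmod (E (t + real i * h)))\<^sup>2) has_integral (\<Sum>i<N. J)) {0..1}"
      by (intro has_integral_sum J) auto
    \<comment> \<open>In each square one factor is bounded by the modulus of continuity and the
      other by an increment of \<open>V\<close>. These increments telescope over one period, which
      stays inside \<open>{0..2}\<close> because \<open>t \<le> 1\<close>.\<close>
    have pt: "(\<Sum>i<N. (cmod (E (t + real i * h)))\<^sup>2) \<le> C * q ^ j * Z" if t: "t \<in> {0..1}" for t
    proof -
      have "(cmod (E (t + real i * h)))\<^sup>2 \<le> C * q ^ j * (V (t + real (Suc i) * h) - V (t + real i * h))"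
        if i: "i < N" for i
      proof -
        have "real (Suc i) * h \<le> real N * h" using i h by (intro mult_right_mono) auto
        then have r: "0 \<le> t + real i * h" "t + real i * h \<le> t + real (Suc i) * h" "t + real (Suc i) * h \<le> 2"
          using t h Nh by (auto intro!: mult_right_mono)
        have 1: "cmod (E (t + real i * h)) \<le> V (t + real (Suc i) * h) - V (t + real i * h)"
          using dom[OF r] by (simp add: E_def algebra_simps)
        have 2: "V (t + real (Suc i) * h) - V (t + real i * h) \<le> C * q ^ j"
        proof (rule modulus[OF r])
          have "t + real (Suc i) * h - (t + real i * h) = h" by (simp add: algebra_simps)
          then show "t + real (Suc i) * h - (t + real i * h) \<le> 1 / 2 ^ (j + 2)" using h_eq by simp
        qed
        have "(cmod (E (t + real i * h)))\<^sup>2 = cmod (E (t + real i * h)) * cmod (E (t + real i * h))"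
          by (rule power2_eq_square)
        also have "\<dots> \<le> C * q ^ j * (V (t + real (Suc i) * h) - V (t + real i * h))"
          using C0 q by (intro mult_mono order_trans[OF 1 2] 1 mult_nonneg_nonneg zero_le_power norm_ge_zero)
        finally show ?thesis .
      qed
      then have "(\<Sum>i<N. (cmod (E (t + real i * h)))\<^sup>2)
          \<le> (\<Sum>i<N. C * q ^ j * (V (t + real (Suc i) * h) - V (t + real i * h)))"
        by (intro sum_mono) auto
      also have "\<dots> = C * q ^ j * (V (t + 1) - V t)"
        unfolding sum_distrib_left[symmetric]
        using sum_lessThan_telescope[of "\<lambda>i. V (t + real i * h)" N] Nh by simp
      also have "V (t + 1) - V t \<le> Z"
        using t Vmono[of 0 t] Vmono[of "t + 1" 2] by (simp add: Z_def)
      finally show ?thesis using C0 q by (simp add: mult_left_mono)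
    qed
    have NJ: "real N * J \<le> C * q ^ j * Z"
      using has_integral_le[OF sumJ has_integral_const_real[of "C * q ^ j * Z" 0 1] pt] by simp
    have coeffE: "coefficient E k = (character k h - 1) * c k" for k
    proof -
      have "continuous_on {0..1} D" "continuous_on {0..1} (\<lambda>t. D (t + h))"
        by (intro continuous_intros continuous_on_compose2[OF cont]; auto)+
      then have "coefficient E k = coefficient (\<lambda>t. D (t + h)) k - coefficient D k"
        unfolding E_def coefficient_def left_diff_distrib
        by (intro integral_diff integrable_continuous_real continuous_intros)
      then show ?thesis
        using coefficient_shift[OF cont per, of h k] h by (simp add: c_def algebra_simps)
    qed
    have factor: "2 \<le> (cmod (character k h - 1))\<^sup>2" if k: "k \<in> block j" for k
    proof -
      define x where "x = 2 * pi * of_int \<bar>k\<bar> * h"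
      have "(2::real) ^ j \<le> of_int \<bar>k\<bar>" "of_int \<bar>k\<bar> < (2::real) ^ (j + 1)"
        using k unfolding block_def by (simp_all only: mem_Collect_eq)
          (metis of_int_le_iff of_int_numeral of_int_power, metis of_int_less_iff of_int_numeral of_int_power)
      then have x: "pi / 2 \<le> x" "x \<le> pi"
        by (simp_all add: x_def h_eq field_simps)
      have "cos (2 * pi * of_int k * h) = cos x"
        by (cases "k \<ge> 0") (simp_all add: x_def)
      also have "cos x \<le> cos (pi / 2)"
        using x by (intro cos_monotone_0_pi_le) auto
      finally have "cos (2 * pi * of_int k * h) \<le> 0" by simp
      moreover have "(cmod (character k h - 1))\<^sup>2 = 2 - 2 * cos (2 * pi * of_int k * h)"
        unfolding character_def cmod_power2
        using sin_cos_squared_add[of "2 * pi * of_int k * h"]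
        by (simp add: power2_eq_square algebra_simps)
      ultimately show ?thesis by simp
    qed
    have "(\<Sum>k\<in>block j. 2 * (cmod (c k))\<^sup>2) \<le> (\<Sum>k\<in>block j. (cmod (coefficient E k))\<^sup>2)"
      unfolding coeffE norm_mult power_mult_distrib
      by (intro sum_mono mult_right_mono factor) auto
    also have "\<dots> \<le> J" unfolding J_def by (rule bessel_inequality[OF contE fin])
    finally have sq: "2 * (\<Sum>k\<in>block j. (cmod (c k))\<^sup>2) \<le> J" by (simp add: sum_distrib_left)
    have cardle: "card (block j) \<le> N"
    proof -
      have "card (block j) \<le> card {- (2 ^ (j + 1))<..(2::int) ^ (j + 1)}"
        by (intro card_mono) (auto simp: block_def)
      also have "\<dots> = N" by (simp add: N_def nat_power_eq nat_mult_distrib)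
      finally show ?thesis .
    qed
    \<comment> \<open>Cauchy-Schwarz costs the cardinality of the block, at most \<open>N\<close>.
      The bound on \<open>N * J\<close> pays for it exactly, so that only the summable factor
      \<open>sqrt q ^ j\<close> remains.\<close>
    have "(\<Sum>k\<in>block j. cmod (c k))\<^sup>2 \<le> (\<Sum>k\<in>block j. (cmod (c k))\<^sup>2) * real (card (block j))"
      by (rule sum_squared_le_sum_of_squares)
    also have "\<dots> \<le> (\<Sum>k\<in>block j. (cmod (c k))\<^sup>2) * real N"
      using cardle by (intro mult_left_mono) (auto intro: sum_nonneg)
    also have "\<dots> \<le> J * real N"
    proof (rule mult_right_mono)
      have "(\<Sum>k\<in>block j. (cmod (c k))\<^sup>2) \<ge> 0" by (intro sum_nonneg) auto
      then show "(\<Sum>k\<in>block j. (cmod (c k))\<^sup>2) \<le> J" using sq by linarith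
    qed simp
    also have "\<dots> \<le> C * Z * q ^ j" using NJ by (simp add: mult_ac)
    finally have "(\<Sum>k\<in>block j. cmod (c k)) \<le> sqrt (C * Z * q ^ j)"
      by (simp add: real_le_rsqrt)
    then show ?thesis by (simp add: real_sqrt_mult real_sqrt_power)
  qed
  define s where "s = sqrt q"
  define A where "A = sqrt (C * Z)"
  have s: "0 \<le> s" "s < 1" using q by (auto simp: s_def)
  have A: "A \<ge> 0" using C0 Z0 by (simp add: A_def)
  define R where "R J = {k::int. \<bar>k\<bar> < 2 ^ J}" for J :: nat
  have finR: "finite (R J)" for J
    by (rule finite_subset[of _ "{- (2 ^ J)..2 ^ J}"]) (auto simp: R_def)
  have Rsum: "(\<Sum>k\<in>R J. cmod (c k)) \<le> cmod (c 0) + A * (\<Sum>j<J. s ^ j)" for J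
  proof (induction J)
    case 0
    have "R 0 = {0}" by (auto simp: R_def)
    then show ?case by simp
  next
    case (Suc J)
    have "R (Suc J) = R J \<union> block J" by (auto simp: R_def block_def)
    then have "(\<Sum>k\<in>R (Suc J). cmod (c k)) \<le> (\<Sum>k\<in>R J. cmod (c k)) + (\<Sum>k\<in>block J. cmod (c k))"
      using finR[of J] fin[of J] by (simp add: sum_Un sum_nonneg)
    also have "\<dots> \<le> cmod (c 0) + A * (\<Sum>j<Suc J. s ^ j)"
      using Suc blockbound[of J] by (simp add: A_def s_def algebra_simps)
    finally show ?case .
  qed
  have "(\<lambda>k. norm (c k)) summable_on UNIV"
  proof (rule nonneg_bounded_partial_sums_imp_summable_on)
    show "eventually (\<lambda>K. (\<Sum>k\<in>K. norm (c k)) \<le> cmod (c 0) + A * (1 / (1 - s))) (finite_subsets_at_top UNIV)"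
    proof (rule eventually_finite_subsets_at_top_weakI)
      fix K :: "int set" assume K: "finite K"
      define J where "J = Max (insert 0 ((\<lambda>k. nat \<bar>k\<bar>) ` K))"
      have "\<bar>k\<bar> < 2 ^ J" if "k \<in> K" for k
      proof -
        have "nat \<bar>k\<bar> \<le> J" unfolding J_def using K that by (intro Max_ge) auto
        then have "nat \<bar>k\<bar> < 2 ^ J" using less_exp[of J] by linarith
        then show ?thesis by (simp add: nat_less_iff)
      qed
      then have "K \<subseteq> R J" by (auto simp: R_def)
      then have "(\<Sum>k\<in>K. norm (c k)) \<le> (\<Sum>k\<in>R J. norm (c k))"
        by (intro sum_mono2 finR) auto
      also note Rsum
      also have "(\<Sum>j<J. s ^ j) \<le> (\<Sum>j. s ^ j)"
        using s by (intro sum_le_suminf summable_geometric) auto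
      also have "\<dots> = 1 / (1 - s)" using s by (intro suminf_geometric) auto
      finally show "(\<Sum>k\<in>K. norm (c k)) \<le> cmod (c 0) + A * (1 / (1 - s))"
        using A by (simp add: mult_left_mono)
    qed
  qed auto
  then show ?thesis by (simp add: c_def)
qed

section \<open>The interpolant\<close>

locale interpolation =
  fixes \<alpha> \<beta> :: real and \<phi> :: "real \<Rightarrow> real"
  assumes \<alpha>_pos: "\<alpha> > 0" and \<beta>_pos: "\<beta> > 0" and interpolant: "interpolant \<alpha> \<beta> \<phi>"
begin

text \<open>The worst factor by which an increment of \<phi> shrinks when the scale is halved. A
  modulus \<open>q ^ n\<close> at scale \<open>1 / 2 ^ n\<close> is Hoelder continuity with exponent
  \<open>- log 2 q\<close>.\<close>

definition q :: real where "q = max \<alpha> \<beta> / (\<alpha> + \<beta>)"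

lemma q_bounds: "1 / 2 \<le> q" "q < 1"
  using \<alpha>_pos \<beta>_pos by (auto simp: q_def field_simps max_def)

lemma weights_le_q: "\<alpha> / (\<alpha> + \<beta>) \<le> q" "\<beta> / (\<alpha> + \<beta>) \<le> q"
  using \<alpha>_pos \<beta>_pos by (auto simp: q_def divide_right_mono)

lemma weights_sum: "\<alpha> / (\<alpha> + \<beta>) + \<beta> / (\<alpha> + \<beta>) = 1"
  using \<alpha>_pos \<beta>_pos by (simp flip: add_divide_distrib)

section \<open>Bounds, monotonicity and modulus of continuity of \<phi>\<close>

lemma continuous_on_phi: "continuous_on {0..1} \<phi>"
  and phi_0 [simp]: "\<phi> 0 = 0"
  and phi_1 [simp]: "\<phi> 1 = 1"
  and phi_lower: "\<lbrakk>0 \<le> t; t \<le> 1 / 2\<rbrakk> \<Longrightarrow> \<phi> t = \<beta> / (\<alpha> + \<beta>) * \<phi> (2 * t)"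
  and phi_upper: "\<lbrakk>1 / 2 \<le> t; t \<le> 1\<rbrakk> \<Longrightarrow> \<phi> t = \<alpha> / (\<alpha> + \<beta>) * \<phi> (2 * t - 1) + \<beta> / (\<alpha> + \<beta>)"
  using interpolant by (auto simp: interpolant_def)

text \<open>A maximum principle: at a maximum point \<open>u\<close> the functional equation writes
  \<open>\<phi> u\<close> as a convex combination, with fixed positive weights, of another value of
  \<phi> and of 0 or 1. The other value is at most \<open>\<phi> u\<close>, which forces
  \<open>\<phi> u\<close> to be at most 0 or 1 respectively.\<close>

lemma phi_le_1:
  assumes "0 \<le> t" "t \<le> 1"
  shows "\<phi> t \<le> 1"
proof -
  define a b where "a = \<alpha> / (\<alpha> + \<beta>)" and "b = \<beta> / (\<alpha> + \<beta>)"
  have ab: "a > 0" "b > 0" "a + b = 1"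
    using \<alpha>_pos \<beta>_pos weights_sum by (auto simp: a_def b_def)
  obtain u where u: "u \<in> {0..1}" "\<And>t. t \<in> {0..1} \<Longrightarrow> \<phi> t \<le> \<phi> u"
    using continuous_attains_sup[of "{0..1}" \<phi>] continuous_on_phi by auto
  have "\<phi> u \<le> 1"
  proof (cases "u \<le> 1 / 2")
    case True
    then have "\<phi> u \<le> b * \<phi> u"
      using u(1) mult_left_mono[OF u(2)[of "2 * u"], of b] phi_lower[of u] ab by (auto simp flip: b_def)
    also have "b * \<phi> u = \<phi> u - a * \<phi> u" using ab by (simp add: algebra_simps flip: distrib_right)
    finally show ?thesis using ab by (simp add: mult_le_0_iff)
  next
    case False
    then have "\<phi> u \<le> a * \<phi> u + b"
      using u(1) mult_left_mono[OF u(2)[of "2 * u - 1"], of a] phi_upper[of u] ab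
      by (auto simp flip: a_def b_def)
    also have "a * \<phi> u + b = \<phi> u + b * (1 - \<phi> u)"
      using ab by (simp add: algebra_simps flip: distrib_right)
    finally show ?thesis using ab by (simp add: zero_le_mult_iff)
  qed
  then show ?thesis using u(2)[of t] assms by simp
qed

text \<open>The same argument at a minimum point.\<close>

lemma phi_ge_0:
  assumes "0 \<le> t" "t \<le> 1"
  shows "0 \<le> \<phi> t"
proof -
  define a b where "a = \<alpha> / (\<alpha> + \<beta>)" and "b = \<beta> / (\<alpha> + \<beta>)"
  have ab: "a > 0" "b > 0" "a + b = 1"
    using \<alpha>_pos \<beta>_pos weights_sum by (auto simp: a_def b_def)
  obtain u where u: "u \<in> {0..1}" "\<And>t. t \<in> {0..1} \<Longrightarrow> \<phi> u \<le> \<phi> t"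
    using continuous_attains_inf[of "{0..1}" \<phi>] continuous_on_phi by auto
  have "0 \<le> \<phi> u"
  proof (cases "u \<le> 1 / 2")
    case True
    then have "b * \<phi> u \<le> \<phi> u"
      using u(1) mult_left_mono[OF u(2)[of "2 * u"], of b] phi_lower[of u] ab by (auto simp flip: b_def)
    moreover have "b * \<phi> u = \<phi> u - a * \<phi> u" using ab by (simp add: algebra_simps flip: distrib_right)
    ultimately show ?thesis using ab by (simp add: zero_le_mult_iff)
  next
    case False
    then have "a * \<phi> u + b \<le> \<phi> u"
      using u(1) mult_left_mono[OF u(2)[of "2 * u - 1"], of a] phi_upper[of u] ab
      by (auto simp flip: a_def b_def)
    moreover have "a * \<phi> u + b = \<phi> u + b * (1 - \<phi> u)"
      using ab by (simp add: algebra_simps flip: distrib_right)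
    ultimately show ?thesis using ab by (simp add: mult_le_0_iff)
  qed
  then show ?thesis using u(2)[of t] assms by simp
qed

lemma phi_diff_lower:
  "\<lbrakk>0 \<le> s; s \<le> t; t \<le> 1 / 2\<rbrakk> \<Longrightarrow> \<phi> t - \<phi> s = \<beta> / (\<alpha> + \<beta>) * (\<phi> (2 * t) - \<phi> (2 * s))"
  using phi_lower[of t] phi_lower[of s] by (simp add: right_diff_distrib)

lemma phi_diff_upper:
  "\<lbrakk>1 / 2 \<le> s; s \<le> t; t \<le> 1\<rbrakk> \<Longrightarrow> \<phi> t - \<phi> s = \<alpha> / (\<alpha> + \<beta>) * (\<phi> (2 * t - 1) - \<phi> (2 * s - 1))"
  using phi_upper[of t] phi_upper[of s] by (simp add: right_diff_distrib)

text \<open>A possible decrease is bounded by \<open>q ^ n\<close> for every \<open>n\<close>. Two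
  points in the same half are rescaled, which costs a factor at most \<open>q\<close>; points in
  different halves are separated by the value \<open>\<beta> / (\<alpha> + \<beta>)\<close> at 1/2,
  so no decrease occurs. The claim follows as \<open>n\<close> grows.\<close>

lemma phi_mono:
  assumes "0 \<le> s" "s \<le> t" "t \<le> 1"
  shows "\<phi> s \<le> \<phi> t"
proof -
  have *: "\<phi> s - \<phi> t \<le> q ^ n" if "0 \<le> s" "s \<le> t" "t \<le> 1" for n s t
    using that
  proof (induction n arbitrary: s t)
    case 0
    then show ?case using phi_le_1[of s] phi_ge_0[of t] by simp
  next
    case (Suc n)
    have scale: "c * d \<le> q * q ^ n" if "0 \<le> c" "c \<le> q" "d \<le> q ^ n" for c d
    proof -
      have "c * d \<le> c * q ^ n" using that by (intro mult_left_mono)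
      also have "\<dots> \<le> q * q ^ n" using that by (intro mult_right_mono zero_le_power) auto
      finally show ?thesis .
    qed
    consider "t \<le> 1 / 2" | "1 / 2 \<le> s" | "s \<le> 1 / 2" "1 / 2 \<le> t" using Suc.prems by linarith
    then show ?case
    proof cases
      case 1
      have "\<phi> s - \<phi> t = \<beta> / (\<alpha> + \<beta>) * (\<phi> (2 * s) - \<phi> (2 * t))"
        using phi_diff_lower[of s t] 1 Suc.prems by (simp add: algebra_simps)
      also have "\<dots> \<le> q * q ^ n"
        using 1 Suc.prems \<alpha>_pos \<beta>_pos by (intro scale Suc.IH weights_le_q) auto
      finally show ?thesis by simp
    next
      case 2
      have "\<phi> s - \<phi> t = \<alpha> / (\<alpha> + \<beta>) * (\<phi> (2 * s - 1) - \<phi> (2 * t - 1))"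
        using phi_diff_upper[of s t] 2 Suc.prems by (simp add: algebra_simps)
      also have "\<dots> \<le> q * q ^ n"
        using 2 Suc.prems \<alpha>_pos \<beta>_pos by (intro scale Suc.IH weights_le_q) auto
      finally show ?thesis by simp
    next
      case 3
      have "\<phi> s = \<beta> / (\<alpha> + \<beta>) * \<phi> (2 * s)" using 3 Suc.prems by (intro phi_lower) auto
      also have "\<dots> \<le> \<beta> / (\<alpha> + \<beta>) * 1"
        using 3 Suc.prems \<alpha>_pos \<beta>_pos by (intro mult_left_mono phi_le_1) auto
      finally have "\<phi> s \<le> \<beta> / (\<alpha> + \<beta>) * 1" .
      moreover have "\<beta> / (\<alpha> + \<beta>) \<le> \<phi> t"
        using phi_upper[of t] 3 Suc.prems \<alpha>_pos \<beta>_pos phi_ge_0[of "2 * t - 1"] by simp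
      moreover have "0 \<le> q ^ Suc n" using q_bounds by (intro zero_le_power) linarith
      ultimately show ?thesis by linarith
    qed
  qed
  have "(\<lambda>n. q ^ n) \<longlonglongrightarrow> 0" using q_bounds by (intro LIMSEQ_power_zero) auto
  then have "\<phi> s - \<phi> t \<le> 0" using *[OF assms] by (intro LIMSEQ_le_const) auto
  then show ?thesis by simp
qed

text \<open>An interval adjoining an endpoint still adjoins it after rescaling, so the recursion
  never meets the midpoint again and the constant is 1. The same holds at the endpoint 1 in the next
  lemma.\<close>

lemma phi_modulus_at_0: "\<lbrakk>0 \<le> t; t \<le> 1 / 2 ^ n\<rbrakk> \<Longrightarrow> \<phi> t \<le> q ^ n"
proof (induction n arbitrary: t)
  case 0
  then show ?case using phi_le_1[of t] by simp
next
  case (Suc n)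
  have "(1::real) / 2 ^ Suc n \<le> 1 / 2" by (simp add: field_simps)
  then have t: "t \<le> 1 / 2" using Suc.prems by linarith
  have "\<phi> t = \<beta> / (\<alpha> + \<beta>) * \<phi> (2 * t)" using t Suc.prems by (simp add: phi_lower)
  also have "\<dots> \<le> q * q ^ n"
    using Suc.prems t \<alpha>_pos \<beta>_pos q_bounds
    by (intro mult_mono weights_le_q Suc.IH phi_ge_0) (auto simp: field_simps)
  finally show ?case by simp
qed

lemma phi_modulus_at_1: "\<lbrakk>t \<le> 1; 1 - t \<le> 1 / 2 ^ n\<rbrakk> \<Longrightarrow> 1 - \<phi> t \<le> q ^ n"
proof (induction n arbitrary: t)
  case 0
  then show ?case using phi_ge_0[of t] by simp
next
  case (Suc n)
  have "(1::real) / 2 ^ Suc n \<le> 1 / 2" by (simp add: field_simps)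
  then have t: "1 / 2 \<le> t" using Suc.prems by linarith
  have "1 - \<phi> t = \<alpha> / (\<alpha> + \<beta>) * (1 - \<phi> (2 * t - 1))"
    using phi_diff_upper[of t 1] t Suc.prems by simp
  also have "\<dots> \<le> q * q ^ n"
  proof (intro mult_mono weights_le_q Suc.IH)
    show "1 - (2 * t - 1) \<le> 1 / 2 ^ n" using Suc.prems(2) by (simp add: field_simps)
    show "0 \<le> 1 - \<phi> (2 * t - 1)" using phi_le_1[of "2 * t - 1"] Suc.prems t by simp
  qed (use Suc.prems q_bounds in auto)
  finally show ?case by simp
qed

text \<open>An interval inside one half is rescaled. Once it contains 1/2, its two parts rescale to
  intervals adjoining an endpoint, and the endpoint moduli finish the estimate without further
  recursion. The constant therefore stays 2 instead of doubling at each level.\<close>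

lemma phi_modulus: "\<lbrakk>0 \<le> s; s \<le> t; t \<le> 1; t - s \<le> 1 / 2 ^ n\<rbrakk> \<Longrightarrow> \<phi> t - \<phi> s \<le> 2 * q ^ n"
proof (induction n arbitrary: s t)
  case 0
  then show ?case using phi_le_1[of t] phi_ge_0[of s] by simp
next
  case (Suc n)
  consider "t \<le> 1 / 2" | "1 / 2 \<le> s" | "s \<le> 1 / 2" "1 / 2 \<le> t" using Suc.prems by linarith
  then show ?case
  proof cases
    case 1
    have "\<phi> t - \<phi> s = \<beta> / (\<alpha> + \<beta>) * (\<phi> (2 * t) - \<phi> (2 * s))"
      using phi_diff_lower[of s t] 1 Suc.prems by simp
    also have "\<dots> \<le> q * (2 * q ^ n)"
    proof (intro mult_mono weights_le_q Suc.IH)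
      show "2 * t - 2 * s \<le> 1 / 2 ^ n" using Suc.prems(4) by (simp add: field_simps)
      show "0 \<le> \<phi> (2 * t) - \<phi> (2 * s)" using phi_mono[of "2 * s" "2 * t"] Suc.prems 1 by simp
    qed (use Suc.prems 1 q_bounds in auto)
    finally show ?thesis by simp
  next
    case 2
    have "\<phi> t - \<phi> s = \<alpha> / (\<alpha> + \<beta>) * (\<phi> (2 * t - 1) - \<phi> (2 * s - 1))"
      using phi_diff_upper[of s t] 2 Suc.prems by simp
    also have "\<dots> \<le> q * (2 * q ^ n)"
    proof (intro mult_mono weights_le_q Suc.IH)
      show "2 * t - 1 - (2 * s - 1) \<le> 1 / 2 ^ n" using Suc.prems(4) by (simp add: field_simps)
      show "0 \<le> \<phi> (2 * t - 1) - \<phi> (2 * s - 1)"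
        using phi_mono[of "2 * s - 1" "2 * t - 1"] Suc.prems 2 by simp
    qed (use Suc.prems 2 q_bounds in auto)
    finally show ?thesis by simp
  next
    case 3
    have half: "2 * t - 2 * s \<le> 1 / 2 ^ n" using Suc.prems(4) by (simp add: field_simps)
    have "\<phi> t - \<phi> (1 / 2) = \<alpha> / (\<alpha> + \<beta>) * \<phi> (2 * t - 1)"
      using phi_diff_upper[of "1 / 2" t] 3 Suc.prems by simp
    also have "\<dots> \<le> q * q ^ n"
    proof (intro mult_mono weights_le_q phi_modulus_at_0)
      show "2 * t - 1 \<le> 1 / 2 ^ n" using half 3 by simp
      show "0 \<le> \<phi> (2 * t - 1)" using phi_ge_0[of "2 * t - 1"] Suc.prems 3 by simp
    qed (use Suc.prems 3 q_bounds in auto)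
    finally have A: "\<phi> t - \<phi> (1 / 2) \<le> q * q ^ n" .
    have "\<phi> (1 / 2) - \<phi> s = \<beta> / (\<alpha> + \<beta>) * (1 - \<phi> (2 * s))"
      using phi_diff_lower[of s "1 / 2"] 3 Suc.prems by simp
    also have "\<dots> \<le> q * q ^ n"
    proof (intro mult_mono weights_le_q phi_modulus_at_1)
      show "1 - 2 * s \<le> 1 / 2 ^ n" using half 3 by simp
      show "0 \<le> 1 - \<phi> (2 * s)" using phi_le_1[of "2 * s"] Suc.prems 3 by simp
    qed (use Suc.prems 3 q_bounds in auto)
    finally show ?thesis using A by simp
  qed
qed

section \<open>Interpolated sequences and their increments\<close>

lemma extend_add:
  assumes "0 \<le> t" "t \<le> 1"
  shows "extend \<phi> a (real n + t) = a n + \<phi> t * (a (n + 1) - a n)"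
proof (cases "t = 1")
  case True
  have "nat \<lfloor>real n + 1\<rfloor> = n + 1" by linarith
  then show ?thesis using True by (simp add: extend_def Let_def)
next
  case False
  then have "nat \<lfloor>real n + t\<rfloor> = n" using assms by linarith
  then show ?thesis by (simp add: extend_def Let_def)
qed

lemma extend_of_nat [simp]: "extend \<phi> a (real n) = a n"
  using extend_add[of 0 a n] by simp

lemma obtain_nat_add:
  assumes "0 \<le> x"
  obtains n t where "x = real n + t" "0 \<le> t" "t < 1"
proof
  show "x = real (nat \<lfloor>x\<rfloor>) + frac x" using assms by (simp add: frac_def)
qed (auto simp: frac_lt_1)

lemma continuous_on_extend: "A \<subseteq> {0..T} \<Longrightarrow> continuous_on A (extend \<phi> a)"
proof -
  have piece: "continuous_on {real n..real (Suc n)} (extend \<phi> a)" for n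
  proof -
    have "continuous_on {real n..real (Suc n)} (\<lambda>x. a n + \<phi> (x - real n) * (a (n + 1) - a n))"
      by (intro continuous_intros continuous_on_compose2[OF continuous_on_phi]) auto
    moreover have "extend \<phi> a x = a n + \<phi> (x - real n) * (a (n + 1) - a n)"
      if "x \<in> {real n..real (Suc n)}" for x
      using extend_add[of "x - real n" a n] that by simp
    ultimately show ?thesis by (metis (no_types, lifting) continuous_on_cong)
  qed
  have "continuous_on {0..real n} (extend \<phi> a)" for n
  proof (induction n)
    case (Suc n)
    have "{0..real (Suc n)} = {0..real n} \<union> {real n..real (Suc n)}" by auto
    then show ?case using Suc piece[of n] by (simp add: continuous_on_closed_Un)
  qed simp
  moreover assume "A \<subseteq> {0..T}"
  moreover obtain n where "T \<le> real n" using real_arch_simple by blast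
  ultimately show ?thesis by (meson atLeastatMost_subset_iff continuous_on_subset order_refl)
qed

lemma extend_linear: "extend \<phi> (\<lambda>n. c * a n + d * b n) x = c * extend \<phi> a x + d * extend \<phi> b x"
  by (simp add: extend_def Let_def algebra_simps)

lemma extend_between:
  assumes "x = real n + t" "0 \<le> t" "t \<le> 1" "a n \<le> a (n + 1)"
  shows "a n \<le> extend \<phi> a x" "extend \<phi> a x \<le> a (n + 1)"
proof -
  show "a n \<le> extend \<phi> a x"
    using assms by (simp add: extend_add phi_ge_0)
  have "\<phi> t * (a (n + 1) - a n) \<le> 1 * (a (n + 1) - a n)"
    using assms phi_le_1[of t] by (intro mult_right_mono) auto
  then show "extend \<phi> a x \<le> a (n + 1)" using assms by (simp add: extend_add)
qed

lemma abs_extend_le: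
  assumes "x = real n + t" "0 \<le> t" "t \<le> 1" "\<bar>a n\<bar> \<le> M" "\<bar>a (n + 1)\<bar> \<le> M"
  shows "\<bar>extend \<phi> a x\<bar> \<le> M"
proof -
  have "extend \<phi> a x = (1 - \<phi> t) * a n + \<phi> t * a (n + 1)"
    using assms(1) extend_add[OF assms(2,3), of a n] by (simp add: algebra_simps)
  also have "\<bar>\<dots>\<bar> \<le> (1 - \<phi> t) * M + \<phi> t * M"
  proof (rule order_trans[OF abs_triangle_ineq add_mono])
    show "\<bar>(1 - \<phi> t) * a n\<bar> \<le> (1 - \<phi> t) * M"
      using assms phi_le_1[of t] by (simp add: abs_mult mult_left_mono)
    show "\<bar>\<phi> t * a (n + 1)\<bar> \<le> \<phi> t * M"
      using assms phi_ge_0[of t] by (simp add: abs_mult mult_left_mono)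
  qed
  finally show ?thesis by (simp add: algebra_simps)
qed

lemma extend_mono:
  assumes mono: "\<And>n. n \<ge> N \<Longrightarrow> a n \<le> a (n + 1)" and xy: "real N \<le> x" "x \<le> y"
  shows "extend \<phi> a x \<le> extend \<phi> a y"
proof -
  have incr: "a m \<le> a n" if "N \<le> m" "m \<le> n" for m n
    using that(2) by (induction rule: dec_induct) (use mono that(1) in \<open>auto intro: order_trans\<close>)
  have xy0: "0 \<le> x" "0 \<le> y" using xy of_nat_0_le_iff[of N] by linarith+
  obtain m s where m: "x = real m + s" "0 \<le> s" "s < 1"
    using xy0 by (auto intro: obtain_nat_add[of x])
  obtain n t where n: "y = real n + t" "0 \<le> t" "t < 1"
    using xy0 by (auto intro: obtain_nat_add[of y])
  have mn: "N \<le> m" "m \<le> n" using m n xy by linarith+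
  show ?thesis
  proof (cases "m = n")
    case True
    then have "\<phi> s \<le> \<phi> t" using m n xy by (intro phi_mono) auto
    then have "\<phi> s * (a (m + 1) - a m) \<le> \<phi> t * (a (m + 1) - a m)"
      using mono[of m] mn by (intro mult_right_mono) auto
    then show ?thesis using m n True by (simp add: extend_add)
  next
    case False
    have "extend \<phi> a x \<le> a (m + 1)"
      using m mono[of m] mn by (intro extend_between(2)[of _ _ s]) auto
    also have "\<dots> \<le> a n" using False mn by (intro incr) auto
    also have "\<dots> \<le> extend \<phi> a y"
      using n mono[of n] mn by (intro extend_between(1)[of _ _ t]) auto
    finally show ?thesis .
  qed
qed

text \<open>The estimate for long intervals: rounding both ends outward to integers adds less than 2
  to the length, and each unit cell contributes at most \<open>B\<close>.\<close>

lemma extend_increment_coarse: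
  assumes incr: "\<And>n. \<lbrakk>N \<le> n; real n \<le> y\<rbrakk> \<Longrightarrow> 0 \<le> a (n + 1) - a n \<and> a (n + 1) - a n \<le> B"
    and xy: "real N \<le> x" "x \<le> y"
  shows "extend \<phi> a y - extend \<phi> a x \<le> (y - x + 2) * B"
proof -
  have xy0: "0 \<le> x" "0 \<le> y" using xy of_nat_0_le_iff[of N] by linarith+
  obtain m s where m: "x = real m + s" "0 \<le> s" "s < 1"
    using xy0 by (auto intro: obtain_nat_add[of x])
  obtain n t where n: "y = real n + t" "0 \<le> t" "t < 1"
    using xy0 by (auto intro: obtain_nat_add[of y])
  have mn: "N \<le> m" "m \<le> n" using m n xy by linarith+
  have step: "a k - a m \<le> (real k - real m) * B" if "m \<le> k" "k \<le> n + 1" for k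
    using that
  proof (induction rule: dec_induct)
    case (step i)
    then show ?case using incr[of i] mn n by (simp add: algebra_simps)
  qed simp
  have "extend \<phi> a y - extend \<phi> a x \<le> a (n + 1) - a m"
    using m n mn xy incr[of n] incr[of m]
    by (intro diff_mono extend_between(2)[of _ _ t] extend_between(1)[of _ _ s]) auto
  also have "\<dots> \<le> (real (n + 1) - real m) * B" using mn by (intro step) auto
  also have "\<dots> \<le> (y - x + 2) * B"
    using m n mn incr[of n] by (intro mult_right_mono) auto
  finally show ?thesis .
qed

text \<open>An interval of length at most 1 meets at most two cells. If it meets two, each part
  adjoins their common integer, so the endpoint moduli give the same constant 2 as within one
  cell.\<close>

lemma extend_increment_fine:
  assumes incr: "\<And>n. \<lbrakk>N \<le> n; real n \<le> y\<rbrakk> \<Longrightarrow> 0 \<le> a (n + 1) - a n \<and> a (n + 1) - a n \<le> B"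
    and xy: "real N \<le> x" "x \<le> y" "y - x \<le> 1 / 2 ^ i"
  shows "extend \<phi> a y - extend \<phi> a x \<le> 2 * q ^ i * B"
proof -
  have xy0: "0 \<le> x" "0 \<le> y" using xy of_nat_0_le_iff[of N] by linarith+
  obtain m s where m: "x = real m + s" "0 \<le> s" "s < 1"
    using xy0 by (auto intro: obtain_nat_add[of x])
  obtain n t where n: "y = real n + t" "0 \<le> t" "t < 1"
    using xy0 by (auto intro: obtain_nat_add[of y])
  have mn: "N \<le> m" "m \<le> n" using m n xy by linarith+
  have "(1::real) / 2 ^ i \<le> 1" by simp
  then have "y - x \<le> 1" using xy by linarith
  then have "n \<le> m + 1" using m n by linarith
  have q0: "0 \<le> q ^ i" using q_bounds by (intro zero_le_power) linarith
  show ?thesis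
  proof (cases "m = n")
    case True
    have st: "s \<le> t" "t - s \<le> 1 / 2 ^ i" using m n True xy by auto
    have "extend \<phi> a y - extend \<phi> a x = (\<phi> t - \<phi> s) * (a (n + 1) - a n)"
      using m n True by (simp add: extend_add left_diff_distrib)
    also have "\<dots> \<le> 2 * q ^ i * B"
      using m n st incr[of n] mn q0 by (intro mult_mono phi_modulus) auto
    finally show ?thesis .
  next
    case False
    then have nm: "n = m + 1" using mn \<open>n \<le> m + 1\<close> by simp
    have ts: "1 - s \<le> 1 / 2 ^ i" "t \<le> 1 / 2 ^ i" using m n nm xy by auto
    have "(1 - \<phi> s) * (a (m + 1) - a m) \<le> q ^ i * B"
      using m n ts incr[of m] mn q0 xy phi_le_1[of s] by (intro mult_mono phi_modulus_at_1) auto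
    moreover have "\<phi> t * (a (n + 1) - a n) \<le> q ^ i * B"
      using m n ts incr[of n] mn q0 by (intro mult_mono phi_modulus_at_0) auto
    moreover have "extend \<phi> a y - extend \<phi> a x
        = (1 - \<phi> s) * (a (m + 1) - a m) + \<phi> t * (a (n + 1) - a n)"
      using extend_add[of s a m] extend_add[of t a n] m n nm by (simp add: left_diff_distrib)
    ultimately show ?thesis by simp
  qed
qed

end

section \<open>The recurrence on the logarithmic scale\<close>

lemma int_summable_shift: "int_summable (\<lambda>m. u (m + 1)) \<longleftrightarrow> int_summable u"
proof -
  have "summable (\<lambda>n. u (int n + 1)) \<longleftrightarrow> summable (\<lambda>n. u (int n))"
    using summable_Suc_iff[of "\<lambda>n. u (int n)"] by (simp add: add.commute)
  moreover have "summable (\<lambda>n. u (- int (Suc n) + 1)) \<longleftrightarrow> summable (\<lambda>n. u (- int (Suc n)))"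
    using summable_Suc_iff[of "\<lambda>n. u (- int n)"] by simp
  ultimately show ?thesis by (simp add: int_summable_def)
qed

text \<open>Only the term \<open>u 0\<close> passes from one half of the series to the
  other.\<close>

lemma int_suminf_shift:
  assumes "int_summable u"
  shows "int_suminf (\<lambda>m. u (m + 1)) = int_suminf u"
proof -
  have "summable (\<lambda>n. u (int n))" "summable (\<lambda>n. u (- int n))"
    using assms summable_Suc_iff[of "\<lambda>n. u (- int n)"] by (auto simp: int_summable_def)
  from this[THEN suminf_split_head]
  have "(\<Sum>n. u (int n + 1)) = (\<Sum>n. u (int n)) - u 0"
    "(\<Sum>n. u (- int (Suc n))) = (\<Sum>n. u (- int n)) - u 0"
    by (simp_all add: add.commute)
  then show ?thesis by (simp add: int_suminf_def)
qed

lemma continuous_on_periodic: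
  fixes p :: "real \<Rightarrow> 'a::topological_space"
  assumes cont: "continuous_on {0..1} p" and per: "\<And>t. p (t + 1) = p t"
  shows "continuous_on UNIV p"
proof -
  have piece: "continuous_on {real_of_int n..of_int n + 1} p" for n
  proof -
    have "continuous_on {real_of_int n..of_int n + 1} (\<lambda>t. p (t - of_int n))"
      by (intro continuous_on_compose2[OF cont] continuous_intros) auto
    moreover have "p (t - of_int n) = p t" for t
      using periodic_of_int[of p "t - of_int n" n, OF per] by simp
    ultimately show ?thesis by simp
  qed
  have "isCont p x" for x
  proof -
    define n where "n = \<lfloor>x\<rfloor>"
    \<comment> \<open>Two adjacent periods are joined so that \<open>x\<close> is an interior point
      even when it is an integer.\<close>
    have "{real_of_int (n - 1)..of_int n + 1} = {real_of_int (n - 1)..of_int (n - 1) + 1} \<union> {real_of_int n..of_int n + 1}"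
      by auto
    then have "continuous_on {real_of_int (n - 1)..of_int n + 1} p"
      using piece[of "n - 1"] piece[of n] by (metis continuous_on_closed_Un closed_atLeastAtMost)
    moreover have "x \<in> interior {real_of_int (n - 1)..of_int n + 1}"
      unfolding interior_atLeastAtMost_real n_def by auto linarith+
    ultimately show ?thesis by (rule continuous_on_interior)
  qed
  then show ?thesis by (simp add: continuous_on_eq_continuous_at)
qed

lemma two_powr_unit: "\<lbrakk>0 \<le> t; t \<le> 1\<rbrakk> \<Longrightarrow> 1 \<le> 2 powr (t::real) \<and> 2 powr t \<le> 2"
  using powr_mono[of 0 t 2] powr_mono[of t 1 2] by simp

lemma powr_eq_two_powr_log: "x > 0 \<Longrightarrow> x powr r = 2 powr (r * log 2 x)" for x r :: real
  by (simp add: powr_def log_def)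

lemma filterlim_log_2: "filterlim (\<lambda>x. log 2 x) at_top at_top"
proof -
  have "filterlim (\<lambda>x::real. 1 / ln 2 * ln x) at_top at_top"
    by (intro filterlim_tendsto_pos_mult_at_top[OF tendsto_const] ln_at_top) auto
  then show ?thesis by (simp add: log_def)
qed

locale recurrence = interpolation +
  fixes f g :: "nat \<Rightarrow> real"
  assumes recurrence: "\<And>n. n \<ge> 2 \<Longrightarrow> f n = \<alpha> * f (nat \<lfloor>real n / 2\<rfloor>) + \<beta> * f (nat \<lceil>real n / 2\<rceil>) + g n"
    and g_1: "g 1 = 0"
begin

abbreviation \<rho> :: real where "\<rho> \<equiv> rho \<alpha> \<beta>"

definition p :: "real \<Rightarrow> real" where
  "p t = 2 powr (- \<rho> * t) * extend0 \<phi> g (2 powr t)"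

definition h :: "real \<Rightarrow> real" where
  "h t = 2 powr (- \<rho> * t) * extend \<phi> f (2 powr t)"

definition S :: "real \<Rightarrow> real" where
  "S t = (\<Sum>m. p (real m + t))"

abbreviation P :: "real \<Rightarrow> real" where "P \<equiv> P_fun \<alpha> \<beta> \<phi> f g"

lemma two_powr_rho: "2 powr \<rho> = \<alpha> + \<beta>"
  using \<alpha>_pos \<beta>_pos by (simp add: rho_def)

lemma f_even: "k \<ge> 1 \<Longrightarrow> f (2 * k) = (\<alpha> + \<beta>) * f k + g (2 * k)"
  using recurrence[of "2 * k"] by (simp add: distrib_right)

lemma f_odd: "k \<ge> 1 \<Longrightarrow> f (2 * k + 1) = \<alpha> * f k + \<beta> * f (k + 1) + g (2 * k + 1)"
proof -
  assume k: "k \<ge> 1"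
  have "\<lfloor>real (2 * k + 1) / 2\<rfloor> = int k" by (rule floor_unique) auto
  moreover have "\<lceil>real (2 * k + 1) / 2\<rceil> = int (k + 1)" by (rule ceiling_unique) auto
  ultimately show ?thesis using recurrence[of "2 * k + 1"] k by (simp only: nat_int)
qed

text \<open>By the recurrence the jumps of f over the two cells between \<open>2 * k\<close> and
  \<open>2 * k + 2\<close> are \<beta> and \<alpha> times its jump from \<open>k\<close> to
  \<open>k + 1\<close>, up to the jumps of g. The functional equations of \<phi> split the doubled
  cell in the same proportion, so interpolation commutes with the recurrence.\<close>

lemma extend_double:
  assumes "x \<ge> 1"
  shows "extend \<phi> f (2 * x) = (\<alpha> + \<beta>) * extend \<phi> f x + extend \<phi> g (2 * x)"
proof -
  obtain k t where k: "x = real k + t" "0 \<le> t" "t < 1"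
    using assms by (auto intro: obtain_nat_add[of x])
  have k1: "k \<ge> 1" using k assms by linarith
  have ab: "\<alpha> + \<beta> \<noteq> 0" using \<alpha>_pos \<beta>_pos by simp
  have x: "extend \<phi> f x = f k + \<phi> t * (f (k + 1) - f k)" using k by (simp add: extend_add)
  show ?thesis
  proof (cases "t \<le> 1 / 2")
    case True
    have d: "extend \<phi> a (2 * x) = a (2 * k) + \<phi> (2 * t) * (a (2 * k + 1) - a (2 * k))" for a
      using extend_add[of "2 * t" a "2 * k"] True k by (simp add: algebra_simps)
    have "(\<alpha> + \<beta>) * \<phi> t = \<beta> * \<phi> (2 * t)" using phi_lower[of t] True k ab by simp
    then have "(\<alpha> + \<beta>) * extend \<phi> f x = (\<alpha> + \<beta>) * f k + \<beta> * \<phi> (2 * t) * (f (k + 1) - f k)"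
      unfolding x by (simp add: distrib_left flip: mult.assoc)
    then show ?thesis unfolding d using f_even[OF k1] f_odd[OF k1] by (simp add: algebra_simps)
  next
    case False
    have d: "extend \<phi> a (2 * x) = a (2 * k + 1) + \<phi> (2 * t - 1) * (a (2 * k + 2) - a (2 * k + 1))" for a
      using extend_add[of "2 * t - 1" a "2 * k + 1"] False k by (simp add: algebra_simps)
    have "(\<alpha> + \<beta>) * \<phi> t = \<alpha> * \<phi> (2 * t - 1) + \<beta>"
      using phi_upper[of t] False k ab by (simp add: distrib_left)
    then have "(\<alpha> + \<beta>) * extend \<phi> f x = (\<alpha> + \<beta>) * f k + (\<alpha> * \<phi> (2 * t - 1) + \<beta>) * (f (k + 1) - f k)"
      unfolding x by (simp add: distrib_left flip: mult.assoc)
    then show ?thesis unfolding d using f_even[of "k + 1"] f_odd[OF k1] by (simp add: algebra_simps)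
  qed
qed

lemma extend0_eq: "x \<ge> 1 \<Longrightarrow> extend0 \<phi> g x = extend \<phi> g x"
  by (simp add: extend0_def)

lemma P_term_eq: "P_term \<alpha> \<beta> \<phi> g t m = p (of_int m + t)"
  by (simp add: P_term_def p_def)

text \<open>Below 0 this is the extension of g by zero, and at 0 it is \<open>g 1 = 0\<close>.
  Consequently the negative half of the series for \<open>P\<close> vanishes on the unit
  interval.\<close>

lemma p_nonpos: "t \<le> 0 \<Longrightarrow> p t = 0"
proof -
  assume "t \<le> 0"
  then have "2 powr t \<le> 2 powr 0" by (intro powr_mono) auto
  then have "extend0 \<phi> g (2 powr t) = 0"
    using extend_of_nat[of g 1] g_1 by (cases "2 powr t = 1") (auto simp: extend0_def)
  then show "p t = 0" by (simp add: p_def)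
qed

lemma h_step: "t \<ge> 0 \<Longrightarrow> h (t + 1) = h t + p (t + 1)"
proof -
  assume t: "t \<ge> 0"
  have 1: "2 powr t \<ge> 1" using t by (simp add: ge_one_powr_ge_zero)
  have 2: "2 powr (t + 1) = 2 * 2 powr t" by (simp add: powr_add)
  have "2 powr (- \<rho> * (t + 1)) * (\<alpha> + \<beta>) = 2 powr (- \<rho> * t)"
    unfolding two_powr_rho[symmetric] by (simp add: powr_add[symmetric] algebra_simps)
  then show ?thesis
    using extend_double[OF 1] 1 unfolding h_def p_def 2
    by (simp add: extend0_eq distrib_left flip: mult.assoc)
qed

text \<open>At \<open>t = 1\<close> the fractional part jumps to 0, but the formula without it also
  gives the value 1 there, because \<open>2 powr (- \<rho>)\<close> cancels
  \<open>\<alpha> + \<beta>\<close>. This agreement makes the periodic function \<open>P0\<close>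
  continuous.\<close>

lemma P0_unit:
  assumes "0 \<le> t" "t \<le> 1"
  shows "P0 \<alpha> \<beta> \<phi> t = (1 + (\<alpha> + \<beta> - 1) * \<phi> (2 powr t - 1)) * 2 powr (- \<rho> * t)"
proof -
  have *: "(\<alpha> + \<beta>) powr - s = 2 powr (- \<rho> * s)" for s
    unfolding two_powr_rho[symmetric] by (simp add: powr_powr)
  show ?thesis
  proof (cases "t = 1")
    case True
    have "2 powr (- \<rho>) = 1 / (\<alpha> + \<beta>)" by (simp add: powr_minus_divide two_powr_rho)
    then show ?thesis using True \<alpha>_pos \<beta>_pos by (simp add: P0_def)
  next
    case False
    then have "frac t = t" using assms by (simp add: frac_eq)
    then show ?thesis unfolding P0_def * by simp
  qed
qed

text \<open>Only \<open>f 1\<close> and \<open>f 2\<close> enter here, and the recurrence for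
  \<open>f 2\<close> separates the contribution of \<open>f 1\<close> from that of
  \<open>g 2\<close>.\<close>

lemma h_unit:
  assumes "0 \<le> t" "t \<le> 1"
  shows "h t = p t + f 1 * P0 \<alpha> \<beta> \<phi> t"
proof -
  define s where "s = 2 powr t - 1"
  have s: "0 \<le> s" "s \<le> 1" "2 powr t = real 1 + s"
    using assms powr_mono[of t 1 2] by (auto simp: s_def ge_one_powr_ge_zero)
  have e1: "extend \<phi> f (2 powr t) = f 1 + \<phi> s * ((\<alpha> + \<beta> - 1) * f 1 + g 2)"
    unfolding s(3) using extend_add[OF s(1,2), of f 1] f_even[of 1]
    by (simp add: numeral_2_eq_2 left_diff_distrib)
  have e2: "extend0 \<phi> g (2 powr t) = \<phi> s * g 2"
    unfolding s(3) using extend_add[OF s(1,2), of g 1] g_1 s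
    by (simp add: extend0_def numeral_2_eq_2)
  show ?thesis
    unfolding h_def p_def P0_unit[OF assms] s_def[symmetric] e1 e2 by (simp add: algebra_simps)
qed

lemma Q_term_eq: "x > 0 \<Longrightarrow> Q_term \<alpha> \<beta> \<phi> g m x = x powr \<rho> * p (real m + log 2 x)"
proof -
  assume x: "x > 0"
  have 1: "2 powr (real m + log 2 x) = 2 ^ m * x" using x by (simp add: powr_add powr_realpow)
  have "x powr \<rho> * 2 powr (- \<rho> * (real m + log 2 x)) = 2 powr (\<rho> * log 2 x) * 2 powr (- \<rho> * (real m + log 2 x))"
    by (subst powr_eq_two_powr_log[OF x]) (rule refl)
  also have "\<dots> = 2 powr (- \<rho> * real m)" by (simp add: powr_add[symmetric] algebra_simps)
  finally show ?thesis unfolding Q_term_def p_def 1 by (simp flip: mult.assoc)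
qed

lemma continuous_on_p [continuous_intros]:
  assumes "A \<subseteq> {0..T}"
  shows "continuous_on A p"
proof -
  have "continuous_on A (\<lambda>t. 2 powr (- \<rho> * t) * extend \<phi> g (2 powr t))"
  proof (intro continuous_intros continuous_on_compose2[OF continuous_on_extend[OF order_refl, where T = "2 powr T"]])
    show "(\<lambda>t. 2 powr t) ` A \<subseteq> {0..2 powr T}" using assms by (auto intro!: powr_mono)
  qed auto
  moreover have "p t = 2 powr (- \<rho> * t) * extend \<phi> g (2 powr t)" if "t \<in> A" for t
    using that assms unfolding p_def by (subst extend0_eq) (auto simp: ge_one_powr_ge_zero)
  ultimately show ?thesis by (metis (no_types, lifting) continuous_on_cong)
qed

lemma continuous_on_P0: "continuous_on {0..1} (P0 \<alpha> \<beta> \<phi>)"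
proof -
  have "continuous_on {0..1} (\<lambda>t. (1 + (\<alpha> + \<beta> - 1) * \<phi> (2 powr t - 1)) * 2 powr (- \<rho> * t))"
    by (intro continuous_intros continuous_on_compose2[OF continuous_on_phi])
      (auto simp: two_powr_unit)
  then show ?thesis using P0_unit by (metis (no_types, lifting) continuous_on_cong atLeastAtMost_iff)
qed

lemma P0_periodic: "P0 \<alpha> \<beta> \<phi> (t + 1) = P0 \<alpha> \<beta> \<phi> t"
  by (simp add: P0_def frac_1_eq)

end

section \<open>The representation of f under uniform convergence of \<open>Q\<close>\<close>

locale convergent_recurrence = recurrence +
  assumes Q_conv: "Q_uniformly_convergent \<alpha> \<beta> \<phi> g"
begin

text \<open>The hypothesis on \<open>Q\<close> is pulled back along \<open>2 powr t\<close>. Its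
  terms carry the factor \<open>(2 powr t) powr \<rho>\<close>, which is divided out, and its sum
  begins at \<open>m = 1\<close>, so the term \<open>p t\<close> is added.\<close>

lemma uniform_limit_S:
  "uniform_limit {0..1} (\<lambda>N t. \<Sum>m<N. p (real m + t)) S sequentially"
proof -
  obtain l where l: "uniform_limit {1..2} (\<lambda>N x. \<Sum>m=1..N. Q_term \<alpha> \<beta> \<phi> g m x) l sequentially"
    using Q_conv by (auto simp: Q_uniformly_convergent_def uniformly_convergent_on_def)
  have "(\<lambda>t::real. 2 powr t) \<in> {0..1} \<rightarrow> {1..2}"
    using two_powr_unit by auto
  from uniform_limit_compose'[OF l this]
  have 1: "uniform_limit {0..1} (\<lambda>N t. \<Sum>m=1..N. Q_term \<alpha> \<beta> \<phi> g m (2 powr t)) (\<lambda>t. l (2 powr t)) sequentially" .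
  \<comment> \<open>Multiplying a uniform limit by a function requires the limit to be bounded;
    continuity on a compact set supplies this.\<close>
  have c1: "continuous_on {0..1} (\<lambda>t. l (2 powr t))"
  proof (rule uniform_limit_theorem[OF _ 1])
    have "continuous_on {0..1} (\<lambda>t. \<Sum>m=1..N. Q_term \<alpha> \<beta> \<phi> g m (2 powr t))" for N
    proof -
      have "continuous_on {0..1} (\<lambda>t. \<Sum>m=1..N. (2 powr t) powr \<rho> * p (real m + t))"
        by (intro continuous_intros continuous_on_compose2[OF continuous_on_p[OF order_refl, where T = "real N + 1"]]) auto
      then show ?thesis by (simp add: Q_term_eq)
    qed
    then show "\<forall>\<^sub>F N in sequentially. continuous_on {0..1} (\<lambda>t. \<Sum>m=1..N. Q_term \<alpha> \<beta> \<phi> g m (2 powr t))"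
      by (intro always_eventually) auto
  qed simp
  have bdd: "bounded (u ` {0..1})" if "continuous_on {0..1} u" for u :: "real \<Rightarrow> real"
    using that by (intro compact_imp_bounded compact_continuous_image) auto
  have "uniform_limit {0..1} (\<lambda>N t. 2 powr (- \<rho> * t) * (\<Sum>m=1..N. Q_term \<alpha> \<beta> \<phi> g m (2 powr t)))
      (\<lambda>t. 2 powr (- \<rho> * t) * l (2 powr t)) sequentially"
    by (intro uniform_lim_mult uniform_limit_const 1 bdd c1 continuous_intros) auto
  moreover have "2 powr (- \<rho> * t) * (\<Sum>m=1..N. Q_term \<alpha> \<beta> \<phi> g m (2 powr t)) = (\<Sum>m=1..N. p (real m + t))" for t N
    unfolding sum_distrib_left
    by (intro sum.cong refl) (simp add: Q_term_eq powr_powr mult.commute powr_minus field_simps)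
  ultimately have "uniform_limit {0..1} (\<lambda>N t. \<Sum>m=1..N. p (real m + t))
      (\<lambda>t. 2 powr (- \<rho> * t) * l (2 powr t)) sequentially" by simp
  then have "uniform_limit {0..1} (\<lambda>N t. p t + (\<Sum>m=1..N. p (real m + t)))
      (\<lambda>t. p t + 2 powr (- \<rho> * t) * l (2 powr t)) sequentially"
    by (intro uniform_limit_add uniform_limit_const)
  moreover have "p t + (\<Sum>m=1..N. p (real m + t)) = (\<Sum>m<Suc N. p (real m + t))" for t N
    by (induction N) auto
  ultimately have "uniform_limit {0..1} (\<lambda>N t. \<Sum>m<Suc N. p (real m + t))
      (\<lambda>t. p t + 2 powr (- \<rho> * t) * l (2 powr t)) sequentially" by simp
  then have 2: "uniform_limit {0..1} (\<lambda>N t. \<Sum>m<N. p (real m + t))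
      (\<lambda>t. p t + 2 powr (- \<rho> * t) * l (2 powr t)) sequentially"
    unfolding uniform_limit_iff
    by (subst (asm) eventually_sequentially_Suc) auto
  have "p t + 2 powr (- \<rho> * t) * l (2 powr t) = S t" if "t \<in> {0..1}" for t
    using tendsto_uniform_limitI[OF 2 that] unfolding S_def
    by (simp add: sums_def sums_unique)
  then show ?thesis by (intro iffD1[OF uniform_limit_cong' 2]) auto
qed

lemma summable_p:
  assumes "t \<ge> 0"
  shows "summable (\<lambda>m. p (real m + t))"
proof -
  have "(\<lambda>N. \<Sum>m<N. p (real m + frac t)) \<longlonglongrightarrow> S (frac t)"
    using tendsto_uniform_limitI[OF uniform_limit_S, of "frac t"] frac_lt_1[of t] by simp
  then have "summable (\<lambda>m. p (real m + frac t))" by (auto simp: summable_def sums_def)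
  then have "summable (\<lambda>m. p (real (m + nat \<lfloor>t\<rfloor>) + frac t))"
    by (subst summable_iff_shift)
  then show ?thesis using assms by (simp add: frac_def)
qed

lemma S_step: "t \<ge> 0 \<Longrightarrow> S t = p t + S (t + 1)"
  using suminf_split_head[OF summable_p[of t]] by (simp add: S_def algebra_simps)

lemma S_tail:
  assumes "0 \<le> t"
  shows "S (real n + t) = S t - (\<Sum>m<n. p (real m + t))"
proof (induction n)
  case (Suc n)
  then show ?case using S_step[of "real n + t"] assms by (simp add: algebra_simps)
qed simp

text \<open>At \<open>real n + t\<close> the function \<open>S\<close> is the error of the
  \<open>n\<close>-th partial sum at \<open>t\<close>. Uniformity in \<open>t\<close> turns
  pointwise convergence into decay along the real line, which is the source of the bound o for
  \<open>Q\<close>.\<close>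

lemma S_tendsto_0: "(S \<longlongrightarrow> 0) at_top"
proof (rule tendstoI)
  fix e :: real assume "e > 0"
  then obtain N where N: "\<And>n t. \<lbrakk>n \<ge> N; t \<in> {0..1}\<rbrakk> \<Longrightarrow> dist (\<Sum>m<n. p (real m + t)) (S t) < e"
    using uniform_limit_S unfolding uniform_limit_iff eventually_sequentially by meson
  have "dist (S t) 0 < e" if t: "t \<ge> real N" for t
  proof -
    have t0: "0 \<le> t" using t of_nat_0_le_iff[of N] by linarith
    have "t = real (nat \<lfloor>t\<rfloor>) + frac t" using t0 by (simp add: frac_def)
    moreover have "nat \<lfloor>t\<rfloor> \<ge> N" using t by linarith
    ultimately show ?thesis
      using N[of "nat \<lfloor>t\<rfloor>" "frac t"] S_tail[of "frac t" "nat \<lfloor>t\<rfloor>"] frac_lt_1[of t]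
      by (simp add: dist_real_def abs_minus_commute)
  qed
  then show "eventually (\<lambda>t. dist (S t) 0 < e) at_top"
    unfolding eventually_at_top_linorder by blast
qed

lemma S_shift_tendsto_0: "((\<lambda>t. S (t + 1)) \<longlongrightarrow> 0) at_top"
  using filterlim_compose[OF S_tendsto_0
      filterlim_tendsto_add_at_top[OF tendsto_const[of 1] filterlim_ident]]
  by (simp add: add.commute)

lemma p_tendsto_0: "(p \<longlongrightarrow> 0) at_top"
proof -
  from tendsto_diff[OF S_tendsto_0 S_shift_tendsto_0] have "((\<lambda>t. S t - S (t + 1)) \<longlongrightarrow> 0) at_top" by simp
  moreover have "eventually (\<lambda>t. S t - S (t + 1) = p t) at_top"
    using eventually_ge_at_top[of 0] by eventually_elim (subst S_step, auto)
  ultimately show ?thesis by (rule Lim_transform_eventually)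
qed

text \<open>Convergence is itself a 1-periodic property of \<open>t\<close>, so
  \<open>periodic_of_int\<close> applied to this truth value reduces the claim to
  \<open>frac t\<close>, where one half of the series is zero.\<close>

lemma int_summable_P_term: "int_summable (P_term \<alpha> \<beta> \<phi> g t)"
proof -
  have shift: "int_summable (P_term \<alpha> \<beta> \<phi> g (t + 1)) = int_summable (P_term \<alpha> \<beta> \<phi> g t)" for t
    using int_summable_shift[of "P_term \<alpha> \<beta> \<phi> g t"] by (simp add: P_term_eq[abs_def] add_ac)
  have "int_summable (P_term \<alpha> \<beta> \<phi> g (frac t))"
  proof -
    have "p (real_of_int (- int (Suc n)) + frac t) = 0" for n
      using frac_lt_1[of t] by (intro p_nonpos) auto
    then show ?thesis
      using summable_p[of "frac t"] unfolding int_summable_def P_term_eq by simp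
  qed
  then show ?thesis
    using periodic_of_int[of "\<lambda>t. int_summable (P_term \<alpha> \<beta> \<phi> g t)" "frac t" "\<lfloor>t\<rfloor>", OF shift]
    by (simp add: frac_def)
qed

lemma P_periodic: "P (t + 1) = P t"
  using int_suminf_shift[OF int_summable_P_term[of t]]
  unfolding P_fun_def P0_periodic by (simp add: P_term_eq[abs_def] add_ac)

lemma P_unit:
  assumes "0 \<le> t" "t \<le> 1"
  shows "P t = S t + f 1 * P0 \<alpha> \<beta> \<phi> t"
proof -
  have "p (real_of_int (- int (Suc n)) + t) = 0" for n
    using assms by (intro p_nonpos) auto
  then show ?thesis unfolding P_fun_def int_suminf_def P_term_eq S_def by simp
qed

text \<open>On the unit interval both sides are computed explicitly. Each further unit step adds to
  \<open>h\<close> exactly the term that the tail of \<open>S\<close> loses.\<close>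

lemma P_eq:
  assumes "t \<ge> 0"
  shows "P t = h t + S (t + 1)"
proof -
  have "P (real n + u) = h (real n + u) + S (real n + u + 1)" if u: "0 \<le> u" "u \<le> 1" for n u
  proof (induction n)
    case 0
    then show ?case using P_unit[OF u] h_unit[OF u] S_step[of u] u by simp
  next
    case (Suc n)
    then show ?case
      using P_periodic[of "real n + u"] h_step[of "real n + u"] S_step[of "real n + u + 1"] u
      by (simp add: algebra_simps)
  qed
  from this[of "frac t" "nat \<lfloor>t\<rfloor>"] show ?thesis
    using assms frac_lt_1[of t] by (simp add: frac_def)
qed

lemma continuous_on_S: "continuous_on {0..1} S"
proof (rule uniform_limit_theorem[OF _ uniform_limit_S])
  have "continuous_on {0..1} (\<lambda>t. \<Sum>m<N. p (real m + t))" for N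
    by (intro continuous_intros continuous_on_compose2[OF continuous_on_p[OF order_refl, where T = "real N + 1"]]) auto
  then show "\<forall>\<^sub>F N in sequentially. continuous_on {0..1} (\<lambda>t. \<Sum>m<N. p (real m + t))"
    by (intro always_eventually) auto
qed simp

lemma continuous_on_P: "continuous_on UNIV P"
proof (rule continuous_on_periodic)
  have "continuous_on {0..1} (\<lambda>t. S t + f 1 * P0 \<alpha> \<beta> \<phi> t)"
    by (intro continuous_intros continuous_on_S continuous_on_P0)
  then show "continuous_on {0..1} P"
    using P_unit by (metis (no_types, lifting) continuous_on_cong atLeastAtMost_iff)
qed (rule P_periodic)

lemma Q_term_sums:
  assumes "x \<ge> 1"
  shows "(\<lambda>m. Q_term \<alpha> \<beta> \<phi> g (Suc m) x) sums (x powr \<rho> * S (log 2 x + 1))"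
proof -
  have "log 2 x \<ge> 0" using assms by simp
  then have "(\<lambda>m. p (real m + (log 2 x + 1))) sums S (log 2 x + 1)"
    unfolding S_def by (intro summable_sums summable_p) simp
  from sums_mult[OF this, of "x powr \<rho>"] show ?thesis
    using assms by (simp add: Q_term_eq algebra_simps)
qed

lemma Q_fun_eq: "x \<ge> 1 \<Longrightarrow> Q_fun \<alpha> \<beta> \<phi> g x = x powr \<rho> * S (log 2 x + 1)"
  unfolding Q_fun_def using Q_term_sums sums_unique by fastforce

lemma extend_f_eq:
  assumes "x \<ge> 1"
  shows "extend \<phi> f x = x powr \<rho> * P (log 2 x) - Q_fun \<alpha> \<beta> \<phi> g x"
proof -
  have "x powr \<rho> = 2 powr (\<rho> * log 2 x)"
    using assms by (intro powr_eq_two_powr_log) auto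
  then have "x powr \<rho> * h (log 2 x) = extend \<phi> f x"
    using assms by (simp add: h_def powr_minus flip: mult.assoc)
  moreover have "log 2 x \<ge> 0" using assms by simp
  ultimately show ?thesis using P_eq[of "log 2 x"] assms by (simp add: Q_fun_eq distrib_left)
qed

lemma Q_fun_smallo: "Q_fun \<alpha> \<beta> \<phi> g \<in> o[at_top](\<lambda>x. x powr \<rho>)"
proof (rule smalloI_tendsto)
  have "((\<lambda>x. S (log 2 x + 1)) \<longlongrightarrow> 0) at_top"
    by (rule filterlim_compose[OF S_shift_tendsto_0 filterlim_log_2])
  moreover have "eventually (\<lambda>x. S (log 2 x + 1) = Q_fun \<alpha> \<beta> \<phi> g x / x powr \<rho>) at_top"
    using eventually_ge_at_top[of 1] by eventually_elim (simp add: Q_fun_eq)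
  ultimately show "((\<lambda>x. Q_fun \<alpha> \<beta> \<phi> g x / x powr \<rho>) \<longlongrightarrow> 0) at_top"
    by (rule Lim_transform_eventually)
  show "eventually (\<lambda>x. x powr \<rho> \<noteq> 0) at_top"
    using eventually_gt_at_top[of 0] by eventually_elim simp
qed

end

section \<open>Fourier coefficients as integrals\<close>

lemma has_integral_two_powr_substitution:
  fixes w :: "real \<Rightarrow> 'a::euclidean_space"
  assumes "a \<le> b" and "continuous_on {2 powr a - c..2 powr b - c} w"
  shows "((\<lambda>t. (ln 2 * 2 powr t) *\<^sub>R w (2 powr t - c)) has_integral
    integral {2 powr a - c..2 powr b - c} w) {a..b}"
proof (rule has_integral_substitution[OF assms(1) _ _ assms(2)])
  show "2 powr a - c \<le> 2 powr b - c" using assms(1) by (simp add: powr_mono)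
  show "(\<lambda>t. 2 powr t - c) ` {a..b} \<subseteq> {2 powr a - c..2 powr b - c}"
    by (auto simp: powr_mono)
  fix x :: real assume "x \<in> {a..b}"
  show "((\<lambda>t. 2 powr t - c) has_field_derivative ln 2 * 2 powr x) (at x within {a..b})"
    unfolding powr_def by (auto intro!: derivative_eq_intros)
qed

text \<open>Monotone convergence for the norms along the exhaustion \<open>{1..2 ^ k}\<close>, then
  dominated convergence for \<open>w\<close>. The endpoints \<open>2 ^ k\<close> are the integers on
  the logarithmic scale.\<close>

lemma absolutely_integrable_on_ray:
  fixes w :: "real \<Rightarrow> complex"
  assumes cont: "\<And>T. continuous_on {1..T} w"
    and bound: "\<And>k::nat. integral {1..2 ^ k} (\<lambda>u. norm (w u)) \<le> B"
  shows "w absolutely_integrable_on {1..}"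
    and "(\<lambda>k::nat. integral {1..2 ^ k} w) \<longlonglongrightarrow> integral {1..} w"
proof -
  define n where "n k u = (if u \<in> {1..2 ^ k} then norm (w u) else 0)" for k :: nat and u
  define v where "v k u = (if u \<in> {1..2 ^ k} then w u else 0)" for k :: nat and u
  have sub: "{1..2 ^ k} \<subseteq> {1::real..}" for k :: nat by auto
  have in_norm: "(n k has_integral integral {1..2 ^ k} (\<lambda>u. norm (w u))) {1..}" for k
    unfolding n_def has_integral_restrict[OF sub]
    by (intro integrable_integral integrable_continuous_real continuous_intros cont)
  have in_w: "(v k has_integral integral {1..2 ^ k} w) {1..}" for k
    unfolding v_def has_integral_restrict[OF sub]
    by (intro integrable_integral integrable_continuous_real cont)
  have ev: "eventually (\<lambda>k::nat. u \<in> {1..2 ^ k}) sequentially" if "u \<in> {1..}" for u :: real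
  proof -
    obtain N :: nat where "u < 2 ^ N" using real_arch_pow[of 2 u] by auto
    then have "u \<le> 2 ^ k" if "k \<ge> N" for k
      using power_increasing[OF that, of "2::real"] by linarith
    then show ?thesis using that by (auto simp: eventually_sequentially)
  qed
  have nonneg: "0 \<le> integral {1..2 ^ k} (\<lambda>u. norm (w u))" for k :: nat
    using in_norm[of k] by (rule has_integral_nonneg) (simp add: n_def)
  have mono: "n k u \<le> n (Suc k) u" if "u \<in> {1..}" for k u
    using power_increasing[of k "Suc k" "2::real"] by (auto simp: n_def)
  have norm_int: "(\<lambda>u. norm (w u)) integrable_on {1..}"
  proof (rule monotone_convergence_increasing[THEN conjunct1])
    show "n k integrable_on {1..}" for k using in_norm by blast
    show "n k u \<le> n (Suc k) u" if "u \<in> {1..}" for k u by (rule mono[OF that])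
    show "(\<lambda>k. n k u) \<longlonglongrightarrow> norm (w u)" if "u \<in> {1..}" for u
      by (intro tendsto_eventually eventually_mono[OF ev[OF that]]) (simp add: n_def)
    show "bounded (range (\<lambda>k. integral {1..} (n k)))"
      unfolding integral_unique[OF in_norm] using bound nonneg
      by (auto simp: bounded_iff intro!: exI[of _ B])
  qed
  have lim: "(\<lambda>k. v k u) \<longlonglongrightarrow> w u" if "u \<in> {1..}" for u
    by (intro tendsto_eventually eventually_mono[OF ev[OF that]]) (simp add: v_def)
  have v: "v k integrable_on {1..}" "norm (v k u) \<le> norm (w u)" for k u
    using in_w by (auto simp: v_def[of k u])
  note dc = dominated_convergence[OF v(1) norm_int v(2) lim]
  then show "(\<lambda>k::nat. integral {1..2 ^ k} w) \<longlonglongrightarrow> integral {1..} w"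
    by (simp add: integral_unique[OF in_w])
  show "w absolutely_integrable_on {1..}"
    using dc(1) norm_int by (rule absolutely_integrable_onI)
qed

lemma integral_0_of_nat:
  fixes w :: "real \<Rightarrow> 'a::euclidean_space"
  assumes "\<And>T. continuous_on {0..T} w"
  shows "integral {0..real N} w = (\<Sum>m<N. integral {0..1} (\<lambda>t. w (real m + t)))"
proof (induction N)
  case (Suc N)
  have "integral {0..real (Suc N)} w = integral {0..real N} w + integral {real N..real (Suc N)} w"
    by (rule Henstock_Kurzweil_Integration.integral_combine[symmetric])
       (auto intro!: integrable_continuous_real assms)
  also have "integral {real N..real (Suc N)} w = integral {0..1} (\<lambda>t. w (real N + t))"
    using integral_shift[of 0 "real N" 1 w] continuous_on_subset[OF assms[of "real N + 1"]]
    by (simp add: o_def add.commute)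
  finally show ?case using Suc by simp
qed simp

lemma of_real_powr_eq_exp: "u > 0 \<Longrightarrow> complex_of_real u powr z = exp (z * of_real (ln u))"
  by (simp add: powr_def Ln_of_real)

lemma fourier_coeff_eq: "fourier_coeff r k = coefficient (\<lambda>t. of_real (r t)) k"
  by (simp add: fourier_coeff_def coefficient_def character_def cis_conv_exp mult_ac)

section \<open>The substitution \<open>u = 2 powr t\<close>\<close>

context recurrence
begin

text \<open>The product of \<open>chi k\<close> and \<open>ln 2\<close> is
  \<open>2 * pi * \<i> * k\<close>, so the power \<open>chi k\<close> of \<open>u\<close> becomes
  the character of index \<open>k\<close> in the logarithmic variable: a Mellin kernel turns into a
  Fourier kernel.\<close>

lemma two_powr_powr_chi:
  "complex_of_real (2 powr t) powr (of_real \<rho> + chi k + 1) = of_real (2 powr ((\<rho> + 1) * t)) * character k t"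
proof -
  have 1: "chi k * of_real (ln 2) = \<i> * of_real (2 * pi * of_int k)"
    by (simp add: chi_def)
  have "(of_real \<rho> + chi k + 1) * of_real (ln (2 powr t))
      = of_real ((\<rho> + 1) * t * ln 2) + (chi k * of_real (ln 2)) * of_real t"
    by (simp add: ln_powr algebra_simps)
  also have "\<dots> = of_real ((\<rho> + 1) * t * ln 2) + \<i> * of_real (2 * pi * of_int k * t)"
    unfolding 1 by simp
  finally have "complex_of_real (2 powr t) powr (of_real \<rho> + chi k + 1)
      = exp (of_real ((\<rho> + 1) * t * ln 2) + \<i> * of_real (2 * pi * of_int k * t))"
    by (simp only: of_real_powr_eq_exp powr_gt_zero zero_less_numeral)
  also have "\<dots> = of_real (2 powr ((\<rho> + 1) * t)) * character k t"
    by (simp add: exp_add character_def cis_conv_exp powr_def exp_of_real[symmetric])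
  finally show ?thesis .
qed

lemma continuous_on_integrand1: "continuous_on {1..T} (integrand1 \<alpha> \<beta> \<phi> g k)"
proof -
  have "continuous_on {1..T} (\<lambda>u. of_real (extend \<phi> g u) / exp ((of_real \<rho> + chi k + 1) * of_real (ln u)))"
    by (intro continuous_intros continuous_on_extend[of _ T]) auto
  moreover have "integrand1 \<alpha> \<beta> \<phi> g k u = of_real (extend \<phi> g u) / exp ((of_real \<rho> + chi k + 1) * of_real (ln u))"
    if "u \<in> {1..T}" for u
    using that by (simp add: integrand1_def extend0_eq of_real_powr_eq_exp)
  ultimately show ?thesis by (metis (no_types, lifting) continuous_on_cong)
qed

lemma continuous_on_integrand2: "continuous_on {0..1} (integrand2 \<alpha> \<beta> \<phi> k)"
proof -
  have "continuous_on {0..1} (\<lambda>u. of_real (1 + (\<alpha> + \<beta> - 1) * \<phi> u) / exp ((of_real \<rho> + chi k + 1) * of_real (ln (1 + u))))"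
    by (intro continuous_intros continuous_on_phi) auto
  moreover have "integrand2 \<alpha> \<beta> \<phi> k u
      = of_real (1 + (\<alpha> + \<beta> - 1) * \<phi> u) / exp ((of_real \<rho> + chi k + 1) * of_real (ln (1 + u)))"
    if "u \<in> {0..1}" for u
    unfolding integrand2_def using that by (subst of_real_powr_eq_exp) auto
  ultimately show ?thesis by (metis (no_types, lifting) continuous_on_cong)
qed

text \<open>The Jacobian \<open>ln 2 * 2 powr t\<close> absorbs the extra 1 in the exponent and
  leaves the factor \<open>ln 2\<close> of the coefficient formula.\<close>

lemma integrand1_two_powr:
  "(ln 2 * 2 powr t) *\<^sub>R integrand1 \<alpha> \<beta> \<phi> g k (2 powr t) = of_real (ln 2) * (of_real (p t) * character (- k) t)"
proof -
  have "2 powr ((\<rho> + 1) * t) * 2 powr (- \<rho> * t) = 2 powr t"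
    by (simp add: powr_add[symmetric] algebra_simps)
  then have "complex_of_real (2 powr ((\<rho> + 1) * t)) * of_real (2 powr (- \<rho> * t)) = of_real (2 powr t)"
    by (metis of_real_mult)
  then show ?thesis
    unfolding integrand1_def two_powr_powr_chi p_def character_inverse scaleR_conv_of_real
    by (simp add: field_simps)
qed

lemma integral_integrand1:
  assumes "T \<ge> 0"
  shows "integral {1..2 powr T} (integrand1 \<alpha> \<beta> \<phi> g k)
    = of_real (ln 2) * integral {0..T} (\<lambda>t. of_real (p t) * character (- k) t)"
  using has_integral_two_powr_substitution[of 0 T 0 "integrand1 \<alpha> \<beta> \<phi> g k"] assms
    continuous_on_integrand1[of "2 powr T" k]
  by (simp add: integrand1_two_powr has_integral_iff)

lemma integral_norm_integrand1:
  assumes "T \<ge> 0"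
  shows "integral {1..2 powr T} (\<lambda>u. norm (integrand1 \<alpha> \<beta> \<phi> g k u)) = ln 2 * integral {0..T} (\<lambda>t. \<bar>p t\<bar>)"
proof -
  have *: "(ln 2 * 2 powr t) *\<^sub>R norm (integrand1 \<alpha> \<beta> \<phi> g k (2 powr t - 0)) = ln 2 * \<bar>p t\<bar>" for t
    using arg_cong[OF integrand1_two_powr[of t k], of norm] by (simp add: norm_mult abs_mult)
  have "((\<lambda>t. (ln 2 * 2 powr t) *\<^sub>R norm (integrand1 \<alpha> \<beta> \<phi> g k (2 powr t - 0))) has_integral
      integral {2 powr 0 - 0..2 powr T - 0} (\<lambda>u. norm (integrand1 \<alpha> \<beta> \<phi> g k u))) {0..T}"
    using assms continuous_on_norm[OF continuous_on_integrand1[of "2 powr T" k]]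
    by (intro has_integral_two_powr_substitution) auto
  then show ?thesis unfolding * by (simp add: has_integral_iff)
qed

text \<open>The substitution is \<open>u = 2 powr t - 1\<close>, which maps the unit interval onto
  itself.\<close>

lemma coefficient_P0:
  "coefficient (\<lambda>t. of_real (P0 \<alpha> \<beta> \<phi> t)) k = 1 / of_real (ln 2) * integral {0..1} (integrand2 \<alpha> \<beta> \<phi> k)"
proof -
  have "((\<lambda>t. (ln 2 * 2 powr t) *\<^sub>R integrand2 \<alpha> \<beta> \<phi> k (2 powr t - 1)) has_integral
      integral {0..1} (integrand2 \<alpha> \<beta> \<phi> k)) {0..1}"
    using has_integral_two_powr_substitution[of 0 1 1 "integrand2 \<alpha> \<beta> \<phi> k"] continuous_on_integrand2[of k]
    by simp
  moreover have "(ln 2 * 2 powr t) *\<^sub>R integrand2 \<alpha> \<beta> \<phi> k (2 powr t - 1)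
      = of_real (ln 2) * (of_real (P0 \<alpha> \<beta> \<phi> t) * character (- k) t)" if "t \<in> {0..1}" for t
  proof -
    have 1: "1 + (2 powr t - 1) = 2 powr t" by simp
    have "2 powr ((\<rho> + 1) * t) * 2 powr (- \<rho> * t) = 2 powr t"
      by (simp add: powr_add[symmetric] algebra_simps)
    then have "complex_of_real (2 powr ((\<rho> + 1) * t)) * of_real (2 powr (- \<rho> * t)) = of_real (2 powr t)"
      by (metis of_real_mult)
    moreover have "P0 \<alpha> \<beta> \<phi> t = (1 + (\<alpha> + \<beta> - 1) * \<phi> (2 powr t - 1)) * 2 powr (- \<rho> * t)"
      using that by (intro P0_unit) auto
    ultimately show ?thesis
      unfolding integrand2_def 1 two_powr_powr_chi character_inverse scaleR_conv_of_real
      by (simp only: of_real_mult) (simp add: field_simps)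
  qed
  ultimately have "((\<lambda>t. of_real (ln 2) * (of_real (P0 \<alpha> \<beta> \<phi> t) * character (- k) t)) has_integral
      integral {0..1} (integrand2 \<alpha> \<beta> \<phi> k)) {0..1}"
    by (rule has_integral_eq[rotated])
  then have "of_real (ln 2) * coefficient (\<lambda>t. of_real (P0 \<alpha> \<beta> \<phi> t)) k = integral {0..1} (integrand2 \<alpha> \<beta> \<phi> k)"
    unfolding coefficient_def integral_mult_right[symmetric] by (rule integral_unique)
  then show ?thesis by (simp add: field_simps)
qed

lemma continuous_on_p_character: "continuous_on {0..T} (\<lambda>t. of_real (p t) * character (- k) t)"
  by (intro continuous_intros) auto

end

section \<open>The coefficient formula with a conditionally convergent integral\<close>

context convergent_recurrence
begin

lemma integral_p_character_tendsto_sequentially: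
  "(\<lambda>N. integral {0..real N} (\<lambda>t. of_real (p t) * character (- k) t))
    \<longlonglongrightarrow> coefficient (\<lambda>t. of_real (S t)) k"
proof -
  have ul: "uniform_limit {0..1} (\<lambda>N t. of_real (\<Sum>m<N. p (real m + t)) * character (- k) t)
      (\<lambda>t. of_real (S t) * character (- k) t) sequentially"
  proof (rule uniform_limitI)
    fix e :: real assume "e > 0"
    from uniform_limitD[OF uniform_limit_S this]
    show "\<forall>\<^sub>F N in sequentially. \<forall>t\<in>{0..1}.
        dist (of_real (\<Sum>m<N. p (real m + t)) * character (- k) t) (of_real (S t) * character (- k) t) < e"
    proof eventually_elim
      case (elim N)
      have "dist (of_real x * character (- k) t) (of_real y * character (- k) t) = dist x y" for x y t
        by (simp only: dist_norm left_diff_distrib[symmetric] of_real_diff[symmetric] norm_mult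
            norm_of_real norm_character real_norm_def mult_1_right)
      with elim show ?case by (simp only:)
    qed
  qed
  obtain I J where I: "\<And>N. ((\<lambda>t. of_real (\<Sum>m<N. p (real m + t)) * character (- k) t) has_integral I N) {0..1}"
    and J: "((\<lambda>t. of_real (S t) * character (- k) t) has_integral J) {0..1}" and lim: "I \<longlonglongrightarrow> J"
  proof (rule uniform_limit_integral[OF ul])
    show "continuous_on {0..1} (\<lambda>t. of_real (\<Sum>m<N. p (real m + t)) * character (- k) t)" for N
      by (intro continuous_intros continuous_on_compose2[OF continuous_on_p[OF order_refl, where T = "real N + 1"]]) auto
  qed auto
  have "I N = integral {0..real N} (\<lambda>t. of_real (p t) * character (- k) t)" for N
  proof -
    have ch: "character (- k) (real m + t) = character (- k) t" for m t
      using character_of_int[of "- k" "int m"] by (simp add: character_add)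
    have "integral {0..real N} (\<lambda>t. of_real (p t) * character (- k) t)
        = (\<Sum>m<N. integral {0..1} (\<lambda>t. of_real (p (real m + t)) * character (- k) t))"
      using integral_0_of_nat[OF continuous_on_p_character, of N k] by (simp add: ch)
    also have "\<dots> = integral {0..1} (\<lambda>t. \<Sum>m<N. of_real (p (real m + t)) * character (- k) t)"
      by (intro integral_sum[symmetric] integrable_continuous_real continuous_intros
          continuous_on_compose2[OF continuous_on_p[OF order_refl, where T = "real N + 1"]]) auto
    also have "\<dots> = I N" using integral_unique[OF I[of N]] by (simp add: sum_distrib_right)
    finally show ?thesis by simp
  qed
  then have "I = (\<lambda>N. integral {0..real N} (\<lambda>t. of_real (p t) * character (- k) t))" by (rule ext)
  then show ?thesis using lim integral_unique[OF J] by (simp add: coefficient_def)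
qed

text \<open>The integral from the integer part of \<open>T\<close> to \<open>T\<close> runs over a
  length at most 1 and \<open>p\<close> tends to 0, so integer and real upper limits give the same
  limit.\<close>

lemma integral_p_character_tendsto:
  "((\<lambda>T. integral {0..T} (\<lambda>t. of_real (p t) * character (- k) t))
    \<longlongrightarrow> coefficient (\<lambda>t. of_real (S t)) k) at_top"
proof -
  define J where "J T = integral {0..T} (\<lambda>t. of_real (p t) * character (- k) t)" for T
  have "filterlim (\<lambda>T::real. nat \<lfloor>T\<rfloor>) sequentially at_top"
    by (rule filterlim_compose[OF filterlim_nat_sequentially filterlim_floor_sequentially])
  from filterlim_compose[OF integral_p_character_tendsto_sequentially[of k] this]
  have 1: "((\<lambda>T::real. J (real (nat \<lfloor>T\<rfloor>))) \<longlongrightarrow> coefficient (\<lambda>t. of_real (S t)) k) at_top"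
    by (simp add: J_def)
  have 2: "((\<lambda>T. J T - J (real (nat \<lfloor>T\<rfloor>))) \<longlongrightarrow> 0) at_top"
  proof (rule tendstoI)
    fix e :: real assume "e > 0"
    then have "eventually (\<lambda>t. dist (p t) 0 < e / 2) at_top"
      using tendstoD[OF p_tendsto_0, of "e / 2"] by simp
    then obtain T0 where T0: "\<And>t. t \<ge> T0 \<Longrightarrow> \<bar>p t\<bar> < e / 2"
      by (auto simp: eventually_at_top_linorder)
    have "dist (J T - J (real (nat \<lfloor>T\<rfloor>))) 0 < e" if T: "T \<ge> max 0 T0 + 1" for T
    proof -
      define n where "n = real (nat \<lfloor>T\<rfloor>)"
      have n: "0 \<le> n" "n \<le> T" "T - n \<le> 1" "T0 \<le> n" using T unfolding n_def by linarith+
      have J: "J T = J n + integral {n..T} (\<lambda>t. of_real (p t) * character (- k) t)"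
        unfolding J_def using n
        by (intro Henstock_Kurzweil_Integration.integral_combine[symmetric] integrable_continuous_real
            continuous_on_p_character) auto
      have "norm (integral {n..T} (\<lambda>t. of_real (p t) * character (- k) t)) \<le> (e / 2) * (T - n)"
      proof (rule integral_bound)
        show "continuous_on {n..T} (\<lambda>t. of_real (p t) * character (- k) t)"
          by (rule continuous_on_subset[OF continuous_on_p_character[of T]]) (use n in auto)
        show "norm (of_real (p t) * character (- k) t) \<le> e / 2" if "t \<in> {n..T}" for t
          using T0[of t] that n by (simp add: norm_mult)
      qed (use n in auto)
      moreover have "(e / 2) * (T - n) \<le> (e / 2) * 1" using n \<open>e > 0\<close> by (intro mult_left_mono) auto
      ultimately have "norm (J T - J n) < e" unfolding J add_diff_cancel_left' using \<open>e > 0\<close> by linarith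
      then show ?thesis by (simp add: n_def)
    qed
    then show "eventually (\<lambda>T. dist (J T - J (real (nat \<lfloor>T\<rfloor>))) 0 < e) at_top"
      unfolding eventually_at_top_linorder by blast
  qed
  from tendsto_add[OF 2 1] show ?thesis by (simp add: J_def)
qed

lemma has_improper_integral_integrand1:
  "has_improper_integral (integrand1 \<alpha> \<beta> \<phi> g k) (of_real (ln 2) * coefficient (\<lambda>t. of_real (S t)) k) 1"
  unfolding has_improper_integral_def
proof (intro conjI allI impI)
  show "integrand1 \<alpha> \<beta> \<phi> g k integrable_on {1..T}" for T
    by (intro integrable_continuous_real continuous_on_integrand1)
  from tendsto_mult[OF tendsto_const filterlim_compose[OF integral_p_character_tendsto filterlim_log_2]]
  have "((\<lambda>T. of_real (ln 2) * integral {0..log 2 T} (\<lambda>t. of_real (p t) * character (- k) t))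
      \<longlongrightarrow> of_real (ln 2) * coefficient (\<lambda>t. of_real (S t)) k) at_top" .
  moreover have "eventually (\<lambda>T. of_real (ln 2) * integral {0..log 2 T} (\<lambda>t. of_real (p t) * character (- k) t)
      = integral {1..T} (integrand1 \<alpha> \<beta> \<phi> g k)) at_top"
    using eventually_ge_at_top[of 1]
  proof eventually_elim
    case (elim T)
    then show ?case using integral_integrand1[of "log 2 T" k] by simp
  qed
  ultimately show "((\<lambda>T. integral {1..T} (integrand1 \<alpha> \<beta> \<phi> g k))
      \<longlongrightarrow> of_real (ln 2) * coefficient (\<lambda>t. of_real (S t)) k) at_top"
    by (rule Lim_transform_eventually)
qed

lemma fourier_coeff_P:
  "fourier_coeff P k = coefficient (\<lambda>t. of_real (S t)) k +
    of_real (f 1) / of_real (ln 2) * integral {0..1} (integrand2 \<alpha> \<beta> \<phi> k)"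
proof -
  have "fourier_coeff P k = integral {0..1} (\<lambda>t. of_real (S t) * character (- k) t
      + of_real (f 1) * (of_real (P0 \<alpha> \<beta> \<phi> t) * character (- k) t))"
    unfolding fourier_coeff_eq coefficient_def
    by (rule integral_cong) (simp add: P_unit algebra_simps)
  also have "\<dots> = coefficient (\<lambda>t. of_real (S t)) k + of_real (f 1) * coefficient (\<lambda>t. of_real (P0 \<alpha> \<beta> \<phi> t)) k"
    unfolding coefficient_def
    by (subst integral_add)
       (auto intro!: integrable_continuous_real continuous_intros continuous_on_S continuous_on_P0)
  finally show ?thesis by (simp add: coefficient_P0)
qed

end

section \<open>Absolute convergence of the integrals from the bound on \<open>A_max\<close>\<close>

locale summable_recurrence = recurrence +
  assumes summable_A: "summable (\<lambda>m. 2 powr (- \<rho> * real m) * A_max g m)"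

context recurrence
begin

lemma A_max_ge: "\<lbrakk>2 ^ m \<le> n; n \<le> 2 ^ (m + 1)\<rbrakk> \<Longrightarrow> \<bar>g n\<bar> \<le> A_max g m"
  unfolding A_max_def by (intro Max_ge) auto

lemma abs_extend_g_le:
  assumes "2 ^ m \<le> x" "x \<le> 2 ^ (m + 1)"
  shows "\<bar>extend \<phi> g x\<bar> \<le> A_max g m"
proof (cases "x = 2 ^ (m + 1)")
  case True
  then show ?thesis using extend_of_nat[of g "2 ^ (m + 1)"] A_max_ge[of m "2 ^ (m + 1)"] by simp
next
  case False
  have "0 \<le> x" using assms(1) by (rule order_trans[rotated]) simp
  then obtain n t where n: "x = real n + t" "0 \<le> t" "t < 1" by (rule obtain_nat_add)
  have "real (2 ^ m) < real (n + 1)" "real n < real (2 ^ (m + 1))" using assms False n by auto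
  then have "2 ^ m \<le> n" "n < 2 ^ (m + 1)" unfolding of_nat_less_iff by auto
  then show ?thesis using n by (intro abs_extend_le[OF n(1)] A_max_ge) auto
qed

lemma abs_Q_term_le:
  assumes "x \<in> {1..2}"
  shows "\<bar>Q_term \<alpha> \<beta> \<phi> g m x\<bar> \<le> 2 powr (- \<rho> * real m) * A_max g m"
proof -
  have 1: "2 ^ m * 1 \<le> 2 ^ m * x" using assms by (intro mult_left_mono) auto
  have 2: "2 ^ m * x \<le> 2 ^ m * 2" using assms by (intro mult_left_mono) auto
  have "(1::real) \<le> 2 ^ m" by simp
  then have "1 \<le> 2 ^ m * x" using 1 by linarith
  then have "\<bar>extend0 \<phi> g (2 ^ m * x)\<bar> \<le> A_max g m"
    using abs_extend_g_le[of m "2 ^ m * x"] 1 2 by (simp add: extend0_eq)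
  then show ?thesis by (simp add: Q_term_def abs_mult)
qed

text \<open>The exponent \<rho> may have either sign, so the factor
  \<open>2 powr (- \<rho> * t)\<close> is bounded by
  \<open>2 powr \<bar>\<rho>\<bar>\<close>.\<close>

lemma abs_p_le:
  assumes "t \<in> {0..1}"
  shows "\<bar>p (real m + t)\<bar> \<le> 2 powr \<bar>\<rho>\<bar> * (2 powr (- \<rho> * real m) * A_max g m)"
proof -
  have "Q_term \<alpha> \<beta> \<phi> g m (2 powr t) = 2 powr (\<rho> * t) * p (real m + t)"
    by (simp add: Q_term_eq powr_powr mult.commute)
  then have "p (real m + t) = 2 powr (- \<rho> * t) * Q_term \<alpha> \<beta> \<phi> g m (2 powr t)"
    by (simp add: powr_minus field_simps)
  moreover have "- \<rho> * t \<le> \<bar>\<rho>\<bar>"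
  proof -
    have "- \<rho> * t \<le> \<bar>\<rho>\<bar> * t" using assms by (intro mult_right_mono) auto
    also have "\<dots> \<le> \<bar>\<rho>\<bar> * 1" using assms by (intro mult_left_mono) auto
    finally show ?thesis by simp
  qed
  ultimately show ?thesis
    using abs_Q_term_le[of "2 powr t" m] two_powr_unit[of t] assms
    by (auto simp: abs_mult intro!: mult_mono powr_mono)
qed

end

sublocale summable_recurrence \<subseteq> convergent_recurrence
proof
  have "uniformly_convergent_on {1..2} (\<lambda>N x. \<Sum>m<N. Q_term \<alpha> \<beta> \<phi> g (Suc m) x)"
  proof (rule Weierstrass_m_test')
    show "norm (Q_term \<alpha> \<beta> \<phi> g (Suc m) x) \<le> 2 powr (- \<rho> * real (Suc m)) * A_max g (Suc m)"
      if "x \<in> {1..2}" for m x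
      using abs_Q_term_le[OF that] by (simp only: real_norm_def)
    show "summable (\<lambda>m. 2 powr (- \<rho> * real (Suc m)) * A_max g (Suc m))"
      using summable_A by (subst summable_Suc_iff)
  qed
  then show "Q_uniformly_convergent \<alpha> \<beta> \<phi> g"
    unfolding Q_uniformly_convergent_def by (simp add: sum.atLeast1_atMost_eq)
qed

context summable_recurrence
begin

lemma integral_abs_p_le:
  "integral {0..real N} (\<lambda>t. \<bar>p t\<bar>) \<le> 2 powr \<bar>\<rho>\<bar> * (\<Sum>m. 2 powr (- \<rho> * real m) * A_max g m)"
proof -
  define M where "M m = 2 powr (- \<rho> * real m) * A_max g m" for m
  have A0: "0 \<le> A_max g m" for m using A_max_ge[of m "2 ^ m"] by force
  have "integral {0..real N} (\<lambda>t. \<bar>p t\<bar>) = (\<Sum>m<N. integral {0..1} (\<lambda>t. \<bar>p (real m + t)\<bar>))"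
    by (rule integral_0_of_nat) (auto intro!: continuous_intros)
  also have "\<dots> \<le> (\<Sum>m<N. 2 powr \<bar>\<rho>\<bar> * M m)"
  proof (rule sum_mono)
    fix m
    have "integral {0..1} (\<lambda>t. \<bar>p (real m + t)\<bar>) \<le> integral {0..1} (\<lambda>t::real. 2 powr \<bar>\<rho>\<bar> * M m)"
      by (intro integral_le integrable_continuous_real continuous_intros
          continuous_on_compose2[OF continuous_on_p[OF order_refl, where T = "real m + 1"]])
         (use abs_p_le[of _ m] in \<open>auto simp: M_def\<close>)
    then show "integral {0..1} (\<lambda>t. \<bar>p (real m + t)\<bar>) \<le> 2 powr \<bar>\<rho>\<bar> * M m" by simp
  qed
  also have "\<dots> = 2 powr \<bar>\<rho>\<bar> * (\<Sum>m<N. M m)" by (simp add: sum_distrib_left)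
  also have "(\<Sum>m<N. M m) \<le> (\<Sum>m. M m)"
    using summable_A A0 by (intro sum_le_suminf) (auto simp: M_def)
  finally show ?thesis by (simp add: M_def mult_left_mono)
qed

text \<open>The integrals of the norm up to \<open>2 ^ j\<close> are bounded because
  \<open>p\<close> is absolutely integrable on the half line. The value is then the limit along
  \<open>2 ^ j\<close>, already identified as a coefficient of \<open>S\<close>.\<close>

lemma absolutely_integrable_integrand1: "integrand1 \<alpha> \<beta> \<phi> g k absolutely_integrable_on {1..}"
  and integral_integrand1_ray:
    "integral {1..} (integrand1 \<alpha> \<beta> \<phi> g k) = of_real (ln 2) * coefficient (\<lambda>t. of_real (S t)) k"
proof -
  have b: "integral {1..2 ^ j} (\<lambda>u. norm (integrand1 \<alpha> \<beta> \<phi> g k u))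
      \<le> ln 2 * (2 powr \<bar>\<rho>\<bar> * (\<Sum>m. 2 powr (- \<rho> * real m) * A_max g m))" for j
    using integral_norm_integrand1[of "real j" k] mult_left_mono[OF integral_abs_p_le[of j], of "ln 2"]
    by (simp add: powr_realpow)
  note ray = absolutely_integrable_on_ray[OF continuous_on_integrand1 b]
  show "integrand1 \<alpha> \<beta> \<phi> g k absolutely_integrable_on {1..}" by (rule ray)
  have "(\<lambda>j. integral {1..2 ^ j} (integrand1 \<alpha> \<beta> \<phi> g k)) \<longlonglongrightarrow> of_real (ln 2) * coefficient (\<lambda>t. of_real (S t)) k"
    using tendsto_mult[OF tendsto_const integral_p_character_tendsto_sequentially, of "of_real (ln 2)" k]
      integral_integrand1[of "real _" k] by (simp add: powr_realpow)
  then show "integral {1..} (integrand1 \<alpha> \<beta> \<phi> g k) = of_real (ln 2) * coefficient (\<lambda>t. of_real (S t)) k"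
    using ray(2) LIMSEQ_unique by blast
qed

end

section \<open>Absolute convergence of the Fourier series\<close>

lemma one_minus_two_powr_le: "0 \<le> d \<Longrightarrow> 1 - 2 powr (- d) \<le> (d::real)"
proof -
  assume d: "0 \<le> d"
  have "1 + (- d * ln 2) \<le> 2 powr (- d)"
    unfolding powr_def using exp_ge_add_one_self[of "- d * ln 2"] by simp
  moreover have "d * ln 2 \<le> d * 1" using d ln_2_less_1 by (intro mult_left_mono) auto
  ultimately show ?thesis by simp
qed

definition variation :: "(nat \<Rightarrow> real) \<Rightarrow> nat \<Rightarrow> real" where
  "variation a n = (\<Sum>j<n. \<bar>a (j + 1) - a j\<bar>)"

lemma variation_Suc: "variation a (n + 1) - variation a n = \<bar>a (n + 1) - a n\<bar>"
  by (simp add: variation_def)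

context interpolation
begin

text \<open>Both \<open>variation a + a\<close> and \<open>variation a - a\<close> are nondecreasing, and interpolation preserves this.\<close>

lemma extend_variation_dominates:
  assumes "0 \<le> x" "x \<le> y"
  shows "\<bar>extend \<phi> a y - extend \<phi> a x\<bar> \<le> extend \<phi> (variation a) y - extend \<phi> (variation a) x"
proof -
  have "extend \<phi> (\<lambda>n. 1 * variation a n + c * a n) x \<le> extend \<phi> (\<lambda>n. 1 * variation a n + c * a n) y"
    if c: "\<bar>c\<bar> = 1" for c :: real
  proof (rule extend_mono[where N = 0])
    fix n :: nat
    have "- (c * (a (n + 1) - a n)) \<le> \<bar>c * (a (n + 1) - a n)\<bar>" by simp
    also have "\<dots> = variation a (n + 1) - variation a n" using c unfolding variation_Suc by (simp add: abs_mult)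
    finally show "1 * variation a n + c * a n \<le> 1 * variation a (n + 1) + c * a (n + 1)"
      by (simp add: algebra_simps)
  qed (use assms in auto)
  from this[of 1] this[of "-1"] show ?thesis unfolding extend_linear by (simp add: abs_le_iff)
qed

text \<open>The window \<open>{1..4}\<close> becomes \<open>2 ^ m\<close> times as long, so
  \<open>2 ^ m * B\<close> is the natural size of the variation. Rounding adds 2 to a length of at
  most \<open>3 * 2 ^ m\<close>, which gives the constant 5. In the modulus, 4 covers the constants
  3 and 2 of the two regimes.\<close>

lemma extend_variation_scaled:
  assumes incr: "\<And>n. \<lbrakk>2 ^ m \<le> n; n < 2 ^ (m + 3)\<rbrakk> \<Longrightarrow> \<bar>a (n + 1) - a n\<bar> \<le> B"
    and xy: "1 \<le> x" "x \<le> y" "y \<le> 4"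
  shows "extend \<phi> (variation a) (2 ^ m * y) - extend \<phi> (variation a) (2 ^ m * x) \<le> 5 * (2 ^ m * B)"
    and "y - x \<le> 1 / 2 ^ j \<Longrightarrow>
      extend \<phi> (variation a) (2 ^ m * y) - extend \<phi> (variation a) (2 ^ m * x) \<le> 4 * (2 ^ m * B) * q ^ j"
proof -
  let ?W = "extend \<phi> (variation a)"
  have one: "(1::real) \<le> 2 ^ m" by simp
  have B: "0 \<le> B" using incr[of "2 ^ m"] by (force intro: order_trans[OF abs_ge_zero])
  have W: "0 \<le> variation a (n + 1) - variation a n \<and> variation a (n + 1) - variation a n \<le> B"
    if "2 ^ m \<le> n" "real n \<le> 2 ^ m * y" for n
  proof -
    have "2 ^ m * y \<le> 2 ^ m * 4" using xy by (intro mult_left_mono) auto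
    then have "real n \<le> 2 ^ m * 4" using that(2) by linarith
    then have "real n \<le> real (2 ^ m * 4)" by simp
    then have "n \<le> 2 ^ m * 4" unfolding of_nat_le_iff .
    also have "\<dots> < 2 ^ (m + 3)" by (simp add: power_add)
    finally show ?thesis using incr[OF that(1)] by (simp only: variation_Suc) auto
  qed
  have xy': "real (2 ^ m) \<le> 2 ^ m * x" "2 ^ m * x \<le> 2 ^ m * y" using xy by auto
  have coarse: "?W (2 ^ m * y) - ?W (2 ^ m * x) \<le> (2 ^ m * y - 2 ^ m * x + 2) * B"
    by (rule extend_increment_coarse[where a = "variation a" and N = "2 ^ m", OF W xy'])
  have "2 ^ m * (y - x) \<le> 2 ^ m * 3" using xy by (intro mult_left_mono) auto
  then have "2 ^ m * y - 2 ^ m * x + 2 \<le> 5 * 2 ^ m"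
    using one unfolding right_diff_distrib by linarith
  then have "(2 ^ m * y - 2 ^ m * x + 2) * B \<le> 5 * 2 ^ m * B"
    using B by (rule mult_right_mono)
  then show "?W (2 ^ m * y) - ?W (2 ^ m * x) \<le> 5 * (2 ^ m * B)"
    using coarse by (simp add: mult.assoc)
  assume j: "y - x \<le> 1 / 2 ^ j"
  have q0: "0 \<le> q" "1 \<le> 2 * q" "q \<le> 1" using q_bounds by auto
  show "?W (2 ^ m * y) - ?W (2 ^ m * x) \<le> 4 * (2 ^ m * B) * q ^ j"
  proof (cases "j \<le> m")
    \<comment> \<open>The dilated length is at most \<open>2 ^ m / 2 ^ j\<close>. This quantity is
      at least 1, so twice it absorbs the rounding term 2, and
      \<open>1 / 2 ^ j \<le> q ^ j\<close>.\<close>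
    case True
    have "2 ^ m * (y - x) \<le> 2 ^ m * (1 / 2 ^ j)" using j by (intro mult_left_mono) auto
    moreover have "(1::real) \<le> 2 ^ m * (1 / 2 ^ j)"
      using power_increasing[OF True, of "2::real"] by (simp add: field_simps)
    ultimately have "2 ^ m * y - 2 ^ m * x + 2 \<le> 3 * (2 ^ m * (1 / 2 ^ j))"
      unfolding right_diff_distrib by linarith
    also have "\<dots> \<le> 4 * (2 ^ m * q ^ j)"
    proof (intro mult_mono)
      show "1 / 2 ^ j \<le> q ^ j" using power_mono[OF q_bounds(1), of j] by (simp add: power_one_over)
    qed auto
    finally have "(2 ^ m * y - 2 ^ m * x + 2) * B \<le> 4 * (2 ^ m * q ^ j) * B"
      using B by (rule mult_right_mono)
    then show ?thesis using coarse by (simp add: mult_ac)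
  next
    \<comment> \<open>The dilated interval has length at most \<open>1 / 2 ^ i\<close> with
      \<open>j = m + i\<close>, which yields \<open>q ^ i\<close>. The missing factor
      \<open>q ^ m\<close> is recovered from \<open>(2 * q) ^ m \<ge> 1\<close>.\<close>
    case False
    then obtain i where i: "j = m + i" by (metis le_add_diff_inverse nat_le_linear)
    have "2 ^ m * (y - x) \<le> 2 ^ m * (1 / 2 ^ j)" using j by (intro mult_left_mono) auto
    then have le: "2 ^ m * y - 2 ^ m * x \<le> 1 / 2 ^ i"
      by (simp add: i power_add right_diff_distrib)
    have "?W (2 ^ m * y) - ?W (2 ^ m * x) \<le> 2 * q ^ i * B"
      by (rule extend_increment_fine[where a = "variation a" and N = "2 ^ m", OF W xy' le])
    also have "\<dots> \<le> 4 * (2 ^ m * q ^ j) * B"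
    proof (rule mult_right_mono[OF _ B])
      have "1 * q ^ i \<le> (2 * q) ^ m * q ^ i"
        using q0 by (intro mult_right_mono one_le_power) auto
      also have "\<dots> = 2 ^ m * q ^ j" by (simp add: i power_add power_mult_distrib)
      finally show "2 * q ^ i \<le> 4 * (2 ^ m * q ^ j)"
        using zero_le_power[OF q0(1), of i] by linarith
    qed
    finally show ?thesis by (simp add: mult_ac)
  qed
qed

end

section \<open>From the bound on \<open>B_max\<close> to the bound on \<open>A_max\<close>\<close>

locale smooth_recurrence = recurrence +
  assumes sum_gt_1: "\<alpha> + \<beta> > 1"
    and summable_B: "summable (\<lambda>m. 2 powr ((1 - \<rho>) * real m) * B_max g m)"

context recurrence
begin

lemma B_max_ge: "\<lbrakk>2 ^ m \<le> n; n < 2 ^ (m + 1)\<rbrakk> \<Longrightarrow> \<bar>g (n + 1) - g n\<bar> \<le> B_max g m"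
  unfolding B_max_def by (intro Max_ge) auto

lemma B_max_nonneg: "0 \<le> B_max g m"
  using B_max_ge[of m "2 ^ m"] by (force intro: order_trans[OF abs_ge_zero])

lemma g_increment_le:
  assumes "2 ^ m \<le> n" "n \<le> 2 ^ (m + 1)"
  shows "\<bar>g n - g (2 ^ m)\<bar> \<le> (real n - 2 ^ m) * B_max g m"
  using assms
proof (induction rule: dec_induct)
  case (step n)
  then show ?case using B_max_ge[of m n] by (simp add: algebra_simps)
qed simp

text \<open>Telescoping from \<open>g 1 = 0\<close> through the dyadic blocks; the
  \<open>j\<close>-th block has \<open>2 ^ j\<close> steps.\<close>

lemma g_power_le: "\<bar>g (2 ^ m)\<bar> \<le> (\<Sum>j<m. 2 ^ j * B_max g j)"
proof (induction m)
  case 0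
  then show ?case using g_1 by simp
next
  case (Suc m)
  then show ?case using g_increment_le[of m "2 ^ Suc m"] by simp
qed

lemma A_max_le: "A_max g m \<le> (\<Sum>j\<le>m. 2 ^ j * B_max g j)"
proof -
  have "\<bar>g n\<bar> \<le> (\<Sum>j\<le>m. 2 ^ j * B_max g j)" if n: "2 ^ m \<le> n" "n \<le> 2 ^ (m + 1)" for n
  proof -
    have "real n \<le> real (2 ^ (m + 1))" using n(2) unfolding of_nat_le_iff .
    then have "(real n - 2 ^ m) * B_max g m \<le> 2 ^ m * B_max g m"
      by (intro mult_right_mono B_max_nonneg) simp
    then show ?thesis
      using g_increment_le[OF n] g_power_le[of m] by (simp add: lessThan_Suc_atMost[symmetric])
  qed
  then show ?thesis unfolding A_max_def by (intro Max.boundedI) auto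
qed

end

text \<open>By \<open>A_max_le\<close> the \<open>m\<close>-th term is at most the
  \<open>m\<close>-th term of the Cauchy product of the series assumed summable with the geometric
  series of ratio \<open>2 powr (- \<rho>)\<close>. The ratio is below 1 because
  \<open>\<alpha> + \<beta> > 1\<close>.\<close>

sublocale smooth_recurrence \<subseteq> summable_recurrence
proof
  define r where "r = 2 powr (- \<rho>)"
  have \<rho>: "\<rho> > 0" using sum_gt_1 by (simp add: rho_def)
  have r: "0 < r" "r < 1" using powr_less_mono[of "- \<rho>" 0 2] \<rho> by (auto simp: r_def)
  have rpow: "2 powr (- \<rho> * real n) = r ^ n" for n
    by (simp add: r_def powr_powr flip: powr_realpow)
  define b where "b j = 2 powr ((1 - \<rho>) * real j) * B_max g j" for j
  have b_eq: "b j = r ^ j * (2 ^ j * B_max g j)" for j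
  proof -
    have "2 powr ((1 - \<rho>) * real j) = 2 powr (- \<rho> * real j) * 2 powr real j"
      by (simp add: powr_add[symmetric] algebra_simps)
    then show ?thesis unfolding b_def rpow[symmetric] by (simp add: powr_realpow)
  qed
  have conv: "summable (\<lambda>k. \<Sum>i\<le>k. b i * r ^ (k - i))"
  proof (rule summable_Cauchy_product)
    show "summable (\<lambda>k. norm (b k))"
      using summable_B B_max_nonneg by (simp add: b_def abs_mult)
    show "summable (\<lambda>k. norm (r ^ k))" using r by (simp add: norm_power)
  qed
  have "norm (2 powr (- \<rho> * real k) * A_max g k) \<le> (\<Sum>i\<le>k. b i * r ^ (k - i))" for k
  proof -
    have "0 \<le> A_max g k" using A_max_ge[of k "2 ^ k"] by force
    then have "norm (2 powr (- \<rho> * real k) * A_max g k) = r ^ k * A_max g k"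
      unfolding rpow using r by simp
    also have "\<dots> \<le> r ^ k * (\<Sum>j\<le>k. 2 ^ j * B_max g j)"
      using r A_max_le by (intro mult_left_mono) auto
    also have "\<dots> = (\<Sum>i\<le>k. b i * r ^ (k - i))"
      unfolding sum_distrib_left
    proof (rule sum.cong[OF refl])
      fix i assume "i \<in> {..k}"
      then have rk: "r ^ k = r ^ i * r ^ (k - i)" by (simp flip: power_add)
      show "r ^ k * (2 ^ i * B_max g i) = b i * r ^ (k - i)" unfolding rk b_eq by (simp only: mult_ac)
    qed
    finally show ?thesis .
  qed
  then show "summable (\<lambda>m. 2 powr (- \<rho> * real m) * A_max g m)"
    by (rule summable_comparison_test'[OF conv])
qed

section \<open>Variation and modulus of continuity of \<open>P\<close>\<close>

context smooth_recurrence
begin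

lemma rho_pos: "\<rho> > 0"
  using sum_gt_1 by (simp add: rho_def)

definition M :: "nat \<Rightarrow> real" where
  "M m = 2 powr (- \<rho> * real m) * (2 ^ m * (B_max g m + B_max g (m + 1) + B_max g (m + 2)))"

lemma summable_M: "summable M"
proof -
  define b where "b j = 2 powr ((1 - \<rho>) * real j) * B_max g j" for j
  have b: "2 powr (- \<rho> * real m) * (2 ^ m * B_max g (m + i)) = 2 powr (- (1 - \<rho>) * real i) * b (m + i)" for m i
  proof -
    have "2 powr (- \<rho> * real m) * 2 ^ m = 2 powr (- \<rho> * real m) * 2 powr real m"
      by (simp add: powr_realpow)
    also have "\<dots> = 2 powr (- (1 - \<rho>) * real i) * 2 powr ((1 - \<rho>) * real (m + i))"
      unfolding powr_add[symmetric] by (simp add: algebra_simps)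
    finally show ?thesis by (simp add: b_def flip: mult.assoc)
  qed
  have "summable (\<lambda>m. 2 powr (- (1 - \<rho>) * real i) * b (m + i))" for i
    using summable_B unfolding b_def[symmetric]
    by (intro summable_mult summable_ignore_initial_segment)
  then have "summable (\<lambda>m. 2 powr (- \<rho> * real m) * (2 ^ m * B_max g (m + i)))" for i
    unfolding b .
  from summable_add[OF summable_add[OF this[of 0] this[of 1]] this[of 2]]
  show ?thesis unfolding M_def[abs_def] by (simp add: distrib_left)
qed

definition W :: "nat \<Rightarrow> real \<Rightarrow> real" where
  "W m x = 2 powr (- \<rho> * real m) * extend \<phi> (variation g) (2 ^ m * x)"

lemma Q_term_dominated:
  assumes "1 \<le> x" "x \<le> y"
  shows "\<bar>Q_term \<alpha> \<beta> \<phi> g m y - Q_term \<alpha> \<beta> \<phi> g m x\<bar> \<le> W m y - W m x"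
proof -
  have m: "2 ^ m * 1 \<le> 2 ^ m * x" "2 ^ m * x \<le> 2 ^ m * y" using assms by (auto intro!: mult_left_mono)
  moreover have "(1::real) \<le> 2 ^ m" by simp
  ultimately have ge: "1 \<le> 2 ^ m * x" "1 \<le> 2 ^ m * y" by linarith+
  have "\<bar>extend \<phi> g (2 ^ m * y) - extend \<phi> g (2 ^ m * x)\<bar>
      \<le> extend \<phi> (variation g) (2 ^ m * y) - extend \<phi> (variation g) (2 ^ m * x)"
    using ge m by (intro extend_variation_dominates) auto
  then have "2 powr (- \<rho> * real m) * \<bar>extend \<phi> g (2 ^ m * y) - extend \<phi> g (2 ^ m * x)\<bar>
      \<le> 2 powr (- \<rho> * real m) * (extend \<phi> (variation g) (2 ^ m * y) - extend \<phi> (variation g) (2 ^ m * x))"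
    by (intro mult_left_mono) auto
  then show ?thesis
    unfolding Q_term_def W_def extend0_eq[OF ge(1)] extend0_eq[OF ge(2)] right_diff_distrib[symmetric] abs_mult
    by simp
qed

lemma W_increment:
  assumes xy: "1 \<le> x" "x \<le> y" "y \<le> 4"
  shows "W m y - W m x \<le> 5 * M m"
    and "y - x \<le> 1 / 2 ^ j \<Longrightarrow> W m y - W m x \<le> 4 * M m * q ^ j"
proof -
  have incr: "\<bar>g (n + 1) - g n\<bar> \<le> B_max g m + B_max g (m + 1) + B_max g (m + 2)"
    if n: "2 ^ m \<le> n" "n < 2 ^ (m + 3)" for n
  proof -
    have e: "(2::nat) ^ (m + 3) = 2 ^ (m + 2 + 1)" "(2::nat) ^ (m + 1 + 1) = 2 ^ (m + 2)"
      by (simp_all add: numeral_eq_Suc)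
    consider "n < 2 ^ (m + 1)" | "2 ^ (m + 1) \<le> n" "n < 2 ^ (m + 1 + 1)" | "2 ^ (m + 2) \<le> n" "n < 2 ^ (m + 2 + 1)"
      using n(2) not_le unfolding e by metis
    then show ?thesis
      using B_max_ge[of m n] B_max_ge[of "m + 1" n] B_max_ge[of "m + 2" n] n(1)
        B_max_nonneg[of m] B_max_nonneg[of "m + 1"] B_max_nonneg[of "m + 2"]
      by cases linarith+
  qed
  let ?c = "2 powr (- \<rho> * real m)"
  note s = extend_variation_scaled[where a = g and m = m, OF incr xy]
  have "?c * (extend \<phi> (variation g) (2 ^ m * y) - extend \<phi> (variation g) (2 ^ m * x))
      \<le> ?c * (5 * (2 ^ m * (B_max g m + B_max g (m + 1) + B_max g (m + 2))))"
    by (intro mult_left_mono s(1)) auto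
  then show "W m y - W m x \<le> 5 * M m"
    unfolding W_def M_def right_diff_distrib[symmetric] by (simp only: mult_ac)
  assume "y - x \<le> 1 / 2 ^ j"
  then have "?c * (extend \<phi> (variation g) (2 ^ m * y) - extend \<phi> (variation g) (2 ^ m * x))
      \<le> ?c * (4 * (2 ^ m * (B_max g m + B_max g (m + 1) + B_max g (m + 2))) * q ^ j)"
    by (intro mult_left_mono s(2)) auto
  then show "W m y - W m x \<le> 4 * M m * q ^ j"
    unfolding W_def M_def right_diff_distrib[symmetric] by (simp only: mult_ac)
qed

lemma W_mono: "\<lbrakk>1 \<le> x; x \<le> y\<rbrakk> \<Longrightarrow> 0 \<le> W m y - W m x"
  using Q_term_dominated[of x y m] by linarith

text \<open>By \<open>extend_f_eq\<close> this is \<open>x powr \<rho> * P (log 2 x)\<close> for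
  \<open>x \<ge> 1\<close>. In the form of a sum its increments can be compared with those of the
  variations of f and g.\<close>

definition F :: "real \<Rightarrow> real" where "F x = extend \<phi> f x + Q_fun \<alpha> \<beta> \<phi> g x"

text \<open>Subtracting the value at 1 makes this a series of increments, which is what
  \<open>W_increment\<close> bounds.\<close>

definition V\<^sub>0 :: "real \<Rightarrow> real" where
  "V\<^sub>0 x = extend \<phi> (variation f) x + (\<Sum>m. W (Suc m) x - W (Suc m) 1)"

lemma summable_W:
  assumes "1 \<le> x" "x \<le> y" "y \<le> 4"
  shows "summable (\<lambda>m. W (Suc m) y - W (Suc m) x)"
proof (rule summable_comparison_test'[where N = 0])
  show "summable (\<lambda>m. 5 * M (Suc m))" using summable_M by (intro summable_mult) (subst summable_Suc_iff)
  show "norm (W (Suc m) y - W (Suc m) x) \<le> 5 * M (Suc m)" for m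
    using W_increment(1)[OF assms, of "Suc m"] W_mono[OF assms(1,2), of "Suc m"] by simp
qed

lemma V\<^sub>0_diff:
  assumes "1 \<le> x" "x \<le> y" "y \<le> 4"
  shows "V\<^sub>0 y - V\<^sub>0 x = (extend \<phi> (variation f) y - extend \<phi> (variation f) x) + (\<Sum>m. W (Suc m) y - W (Suc m) x)"
  using suminf_diff[OF summable_W[of 1 y] summable_W[of 1 x]] assms by (simp add: V\<^sub>0_def)

lemma F_dominated:
  assumes "1 \<le> x" "x \<le> y" "y \<le> 4"
  shows "\<bar>F y - F x\<bar> \<le> V\<^sub>0 y - V\<^sub>0 x"
proof -
  let ?d = "\<lambda>m. Q_term \<alpha> \<beta> \<phi> g (Suc m) y - Q_term \<alpha> \<beta> \<phi> g (Suc m) x"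
  have sx: "summable (\<lambda>m. Q_term \<alpha> \<beta> \<phi> g (Suc m) x)" and sy: "summable (\<lambda>m. Q_term \<alpha> \<beta> \<phi> g (Suc m) y)"
    using Q_term_sums[of x] Q_term_sums[of y] assms by (auto simp: sums_iff)
  have le: "\<bar>?d m\<bar> \<le> W (Suc m) y - W (Suc m) x" for m using assms by (intro Q_term_dominated) auto
  have sd: "summable (\<lambda>m. \<bar>?d m\<bar>)"
    by (rule summable_comparison_test'[OF summable_W[OF assms], where N = 0]) (use le in auto)
  have Q: "Q_fun \<alpha> \<beta> \<phi> g y - Q_fun \<alpha> \<beta> \<phi> g x = (\<Sum>m. ?d m)"
    unfolding Q_fun_def by (rule suminf_diff[OF sy sx])
  have "\<bar>Q_fun \<alpha> \<beta> \<phi> g y - Q_fun \<alpha> \<beta> \<phi> g x\<bar> \<le> (\<Sum>m. W (Suc m) y - W (Suc m) x)"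
    unfolding Q by (rule order_trans[OF summable_rabs[OF sd] suminf_le[OF le sd summable_W[OF assms]]])
  moreover have "\<bar>extend \<phi> f y - extend \<phi> f x\<bar> \<le> extend \<phi> (variation f) y - extend \<phi> (variation f) x"
    using assms by (intro extend_variation_dominates) auto
  ultimately show ?thesis unfolding F_def V\<^sub>0_diff[OF assms] by linarith
qed

lemma V\<^sub>0_modulus:
  obtains C where "\<And>x y j. \<lbrakk>1 \<le> x; x \<le> y; y \<le> 4; y - x \<le> 1 / 2 ^ j\<rbrakk> \<Longrightarrow> V\<^sub>0 y - V\<^sub>0 x \<le> C * q ^ j"
proof
  fix x y :: real and j :: nat
  assume xy: "1 \<le> x" "x \<le> y" "y \<le> 4" and j: "y - x \<le> 1 / 2 ^ j"
  \<comment> \<open>The bound 8 is \<open>2 ^ (0 + 3)\<close>: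
    \<open>extend_variation_scaled\<close> is used for f without dilation, at
    \<open>m = 0\<close>.\<close>
  define B where "B = (\<Sum>n<8. \<bar>f (n + 1) - f n\<bar>)"
  have "\<bar>f (n + 1) - f n\<bar> \<le> B" if "n < 8" for n
    unfolding B_def using member_le_sum[of n "{..<8}" "\<lambda>n. \<bar>f (n + 1) - f n\<bar>"] that by auto
  then have 1: "extend \<phi> (variation f) y - extend \<phi> (variation f) x \<le> 4 * B * q ^ j"
    using extend_variation_scaled(2)[of 0 f B x y j] xy j by simp
  have sM: "summable (\<lambda>m. M (Suc m))" using summable_M by (subst summable_Suc_iff)
  have "(\<Sum>m. W (Suc m) y - W (Suc m) x) \<le> (\<Sum>m. 4 * q ^ j * M (Suc m))"
    by (intro suminf_le summable_W[OF xy] summable_mult sM)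
       (use W_increment(2)[OF xy j, of "Suc _"] in \<open>simp add: mult_ac\<close>)
  also have "\<dots> = 4 * q ^ j * (\<Sum>m. M (Suc m))" by (rule suminf_mult[OF sM])
  finally show "V\<^sub>0 y - V\<^sub>0 x \<le> (4 * (\<Sum>n<8. \<bar>f (n + 1) - f n\<bar>) + 4 * (\<Sum>m. M (Suc m))) * q ^ j"
    using 1 unfolding V\<^sub>0_diff[OF xy] by (simp add: algebra_simps B_def)
qed

lemma P_eq_F:
  assumes "t \<ge> 0"
  shows "P t = 2 powr (- \<rho> * t) * F (2 powr t)"
proof -
  have "F (2 powr t) = (2 powr t) powr \<rho> * P t"
    using extend_f_eq[of "2 powr t"] assms by (simp add: F_def ge_one_powr_ge_zero)
  then show ?thesis by (simp add: powr_powr powr_minus mult.commute)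
qed

text \<open>A product rule: \<open>P t\<close> is the product of the decreasing factor
  \<open>2 powr (- \<rho> * t)\<close>, at most 1 for \<open>t \<ge> 0\<close>, and of
  \<open>F (2 powr t)\<close>, bounded by \<open>K\<close>. The two parts of an increment are
  dominated by the increments of \<open>V\<^sub>0 (2 powr t)\<close> and of the nondecreasing
  function \<open>- K * 2 powr (- \<rho> * t)\<close>.\<close>

lemma summable_coefficients_P: "(\<lambda>k. norm (coefficient (\<lambda>t. of_real (P t)) k)) summable_on UNIV"
proof -
  obtain C where C: "\<And>x y j. \<lbrakk>1 \<le> x; x \<le> y; y \<le> 4; y - x \<le> 1 / 2 ^ j\<rbrakk> \<Longrightarrow> V\<^sub>0 y - V\<^sub>0 x \<le> C * q ^ j"
    by (rule V\<^sub>0_modulus) blast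
  define K where "K = \<bar>F 1\<bar> + (V\<^sub>0 4 - V\<^sub>0 1)"
  have K: "\<bar>F x\<bar> \<le> K" if "1 \<le> x" "x \<le> 4" for x
    using F_dominated[of 1 x] F_dominated[of x 4] that unfolding K_def by force
  have K0: "0 \<le> K" using K[of 1] by linarith
  define V where "V t = V\<^sub>0 (2 powr t) - K * 2 powr (- \<rho> * t)" for t
  have range: "1 \<le> 2 powr s" "2 powr s \<le> 2 powr t" "2 powr t \<le> 4" if "0 \<le> s" "s \<le> t" "t \<le> 2" for s t :: real
    using that powr_mono[of t 2 2] by (auto simp: ge_one_powr_ge_zero powr_mono)
  have decr: "2 powr (- \<rho> * t) \<le> 2 powr (- \<rho> * s)" "2 powr (- \<rho> * t) \<le> 1"
    "2 powr (- \<rho> * s) - 2 powr (- \<rho> * t) \<le> \<rho> * (t - s)" if "0 \<le> s" "s \<le> t" for s t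
  proof -
    have le1: "2 powr (- \<rho> * u) \<le> 1" if "0 \<le> u" for u
      using powr_mono[of "- \<rho> * u" 0 2] that rho_pos by simp
    show "2 powr (- \<rho> * t) \<le> 2 powr (- \<rho> * s)" using that rho_pos by (intro powr_mono) auto
    show "2 powr (- \<rho> * t) \<le> 1" using that by (intro le1) auto
    have "2 powr (- \<rho> * s) - 2 powr (- \<rho> * t) = 2 powr (- \<rho> * s) * (1 - 2 powr (- (\<rho> * (t - s))))"
      by (simp add: right_diff_distrib powr_add[symmetric] algebra_simps)
    also have "\<dots> \<le> 1 * (\<rho> * (t - s))"
    proof (rule mult_mono[OF le1[OF that(1)] one_minus_two_powr_le])
      show "0 \<le> \<rho> * (t - s)" using that rho_pos by simp
      then show "0 \<le> 1 - 2 powr (- (\<rho> * (t - s)))" using powr_mono[of "- (\<rho> * (t - s))" 0 2] by simp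
    qed simp
    finally show "2 powr (- \<rho> * s) - 2 powr (- \<rho> * t) \<le> \<rho> * (t - s)" by simp
  qed
  show ?thesis
  proof (rule summable_coefficients_if_bounded_variation[where V = V and q = q and C = "C + K * \<rho>"])
    show "continuous_on UNIV (\<lambda>t. complex_of_real (P t))"
      by (intro continuous_intros continuous_on_P)
    show "complex_of_real (P (t + 1)) = of_real (P t)" for t by (simp add: P_periodic)
    show "0 \<le> q" "q < 1" using q_bounds by auto
    fix s t :: real assume st: "0 \<le> s" "s \<le> t" "t \<le> 2"
    note r = range[OF st]
    have Pts: "P t - P s = 2 powr (- \<rho> * t) * (F (2 powr t) - F (2 powr s))
        - F (2 powr s) * (2 powr (- \<rho> * s) - 2 powr (- \<rho> * t))"
      using P_eq_F[of s] P_eq_F[of t] st by (simp add: algebra_simps)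
    have "\<bar>P t - P s\<bar> \<le> \<bar>2 powr (- \<rho> * t) * (F (2 powr t) - F (2 powr s))\<bar>
        + \<bar>F (2 powr s) * (2 powr (- \<rho> * s) - 2 powr (- \<rho> * t))\<bar>"
      unfolding Pts by (rule abs_triangle_ineq4)
    also have "\<dots> \<le> 1 * (V\<^sub>0 (2 powr t) - V\<^sub>0 (2 powr s)) + K * (2 powr (- \<rho> * s) - 2 powr (- \<rho> * t))"
      unfolding abs_mult
    proof (intro add_mono mult_mono)
      show "\<bar>2 powr (- \<rho> * t)\<bar> \<le> 1" using decr(2)[OF st(1,2)] by simp
      show "\<bar>F (2 powr t) - F (2 powr s)\<bar> \<le> V\<^sub>0 (2 powr t) - V\<^sub>0 (2 powr s)" by (rule F_dominated[OF r])
      show "\<bar>F (2 powr s)\<bar> \<le> K" by (rule K[OF r(1) order_trans[OF r(2,3)]])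
      show "\<bar>2 powr (- \<rho> * s) - 2 powr (- \<rho> * t)\<bar> \<le> 2 powr (- \<rho> * s) - 2 powr (- \<rho> * t)"
        using decr(1)[OF st(1,2)] by simp
    qed (use K0 in auto)
    also have "\<dots> = V t - V s" by (simp add: V_def algebra_simps)
    finally show "cmod (of_real (P t) - of_real (P s)) \<le> V t - V s"
      by (simp only: of_real_diff[symmetric] norm_of_real)
    fix j assume j: "t - s \<le> 1 / 2 ^ (j + 2)"
    have "2 powr t - 2 powr s = 2 powr t * (1 - 2 powr (- (t - s)))"
      by (simp add: right_diff_distrib powr_add[symmetric])
    \<comment> \<open>The constant 4 is the maximum of \<open>2 powr t\<close> on
      \<open>{0..2}\<close>; it is cancelled by the additional \<open>2 ^ 2\<close> in the scale
      \<open>1 / 2 ^ (j + 2)\<close>.\<close>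
    also have "\<dots> \<le> 4 * (t - s)"
    proof (rule mult_mono[OF r(3) one_minus_two_powr_le])
      show "0 \<le> t - s" using st by simp
      then show "0 \<le> 1 - 2 powr (- (t - s))" using powr_mono[of "- (t - s)" 0 2] by simp
    qed simp
    also have "\<dots> \<le> 1 / 2 ^ j" using j by (simp add: power_add)
    finally have "V\<^sub>0 (2 powr t) - V\<^sub>0 (2 powr s) \<le> C * q ^ j" by (rule C[OF r])
    moreover have "K * (2 powr (- \<rho> * s) - 2 powr (- \<rho> * t)) \<le> K * (\<rho> * q ^ j)"
    proof (rule mult_left_mono[OF _ K0])
      \<comment> \<open>The exponential factor is Lipschitz, and since \<open>q \<ge> 1 / 2\<close>
        a Lipschitz modulus is at least as good as \<open>q ^ j\<close>.\<close>
      have "(1::real) / 2 ^ (j + 2) \<le> 1 / 2 ^ j" by (simp add: power_add field_simps)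
      also have "1 / 2 ^ j \<le> q ^ j" using power_mono[OF q_bounds(1), of j] by (simp add: power_one_over)
      finally have "t - s \<le> q ^ j" using j by linarith
      then show "2 powr (- \<rho> * s) - 2 powr (- \<rho> * t) \<le> \<rho> * q ^ j"
        using decr(3)[OF st(1,2)] mult_left_mono[of "t - s" "q ^ j" \<rho>] rho_pos by linarith
    qed
    ultimately show "V t - V s \<le> (C + K * \<rho>) * q ^ j" by (simp add: V_def algebra_simps)
  qed
qed

lemma has_sum_fourier_P:
  "((\<lambda>k. fourier_coeff P k * character k t) has_sum of_real (P t)) UNIV"
  unfolding fourier_coeff_eq
proof (rule has_sum_fourier_series[of "\<lambda>t. of_real (P t)"])
  show "continuous_on UNIV (\<lambda>t. complex_of_real (P t))"
    by (intro continuous_intros continuous_on_P)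
qed (simp_all add: P_periodic summable_coefficients_P)

end

theorem theorem3p6:
  fixes \<alpha> \<beta> :: real and \<phi> :: "real \<Rightarrow> real" and f g :: "nat \<Rightarrow> real"
  assumes "\<alpha> > 0" and "\<beta> > 0"
    and "\<forall>n\<ge>2. f n = \<alpha> * f (nat \<lfloor>real n / 2\<rfloor>) + \<beta> * f (nat \<lceil>real n / 2\<rceil>) + g n"
    and "g 1 = 0"
    and "interpolant \<alpha> \<beta> \<phi>"
  shows
    "(Q_uniformly_convergent \<alpha> \<beta> \<phi> g \<longrightarrow>
        (\<forall>x\<ge>1. summable (\<lambda>m. Q_term \<alpha> \<beta> \<phi> g (Suc m) x) \<and>
           extend \<phi> f x =
             x powr rho \<alpha> \<beta> * P_fun \<alpha> \<beta> \<phi> f g (log 2 x) - Q_fun \<alpha> \<beta> \<phi> g x) \<and>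
        Q_fun \<alpha> \<beta> \<phi> g \<in> o[at_top](\<lambda>x. x powr rho \<alpha> \<beta>) \<and>
        (\<forall>t. int_summable (P_term \<alpha> \<beta> \<phi> g t)) \<and>
        continuous_on UNIV (P_fun \<alpha> \<beta> \<phi> f g) \<and>
        (\<forall>t. P_fun \<alpha> \<beta> \<phi> f g (t + 1) = P_fun \<alpha> \<beta> \<phi> f g t) \<and>
        (\<forall>k. \<exists>I. has_improper_integral (integrand1 \<alpha> \<beta> \<phi> g k) I 1 \<and>
           fourier_coeff (P_fun \<alpha> \<beta> \<phi> f g) k =
             1 / of_real (ln 2) * I +
             of_real (f 1) / of_real (ln 2) * integral {0..1} (integrand2 \<alpha> \<beta> \<phi> k))) \<and>
     (summable (\<lambda>m. 2 powr (- rho \<alpha> \<beta> * real m) * A_max g m) \<longrightarrow>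
        Q_uniformly_convergent \<alpha> \<beta> \<phi> g \<and>
        (\<forall>k. integrand1 \<alpha> \<beta> \<phi> g k absolutely_integrable_on {1..} \<and>
           integrand2 \<alpha> \<beta> \<phi> k absolutely_integrable_on {0..1} \<and>
           fourier_coeff (P_fun \<alpha> \<beta> \<phi> f g) k =
             1 / of_real (ln 2) * integral {1..} (integrand1 \<alpha> \<beta> \<phi> g k) +
             of_real (f 1) / of_real (ln 2) * integral {0..1} (integrand2 \<alpha> \<beta> \<phi> k))) \<and>
     (\<alpha> + \<beta> > 1 \<and> summable (\<lambda>m. 2 powr ((1 - rho \<alpha> \<beta>) * real m) * B_max g m) \<longrightarrow>
        Q_uniformly_convergent \<alpha> \<beta> \<phi> g \<and>
        (\<lambda>k. norm (fourier_coeff (P_fun \<alpha> \<beta> \<phi> f g) k)) summable_on UNIV \<and>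
        (\<forall>t. ((\<lambda>k. fourier_coeff (P_fun \<alpha> \<beta> \<phi> f g) k *
                 exp (2 * of_real pi * \<i> * of_int k * of_real t))
               has_sum of_real (P_fun \<alpha> \<beta> \<phi> f g t)) UNIV) \<and>
        (\<forall>k. integrand1 \<alpha> \<beta> \<phi> g k absolutely_integrable_on {1..} \<and>
           integrand2 \<alpha> \<beta> \<phi> k absolutely_integrable_on {0..1} \<and>
           fourier_coeff (P_fun \<alpha> \<beta> \<phi> f g) k =
             1 / of_real (ln 2) * integral {1..} (integrand1 \<alpha> \<beta> \<phi> g k) +
             of_real (f 1) / of_real (ln 2) * integral {0..1} (integrand2 \<alpha> \<beta> \<phi> k)))"
  (is "(?conv \<longrightarrow> ?a) \<and> (?sumA \<longrightarrow> ?conv \<and> ?b) \<and> (_ \<and> ?sumB \<longrightarrow> ?conv \<and> ?c \<and> ?d \<and> ?b)")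
proof -
  interpret recurrence \<alpha> \<beta> \<phi> f g
    using assms by unfold_locales auto
  have abs2: "integrand2 \<alpha> \<beta> \<phi> k absolutely_integrable_on {0..1}" for k
    by (intro absolutely_integrable_continuous_real continuous_on_integrand2)
  have b: "?conv \<and> ?b" if ?sumA
  proof -
    interpret summable_recurrence \<alpha> \<beta> \<phi> f g using that by unfold_locales
    show ?thesis
      using Q_conv absolutely_integrable_integrand1 abs2 integral_integrand1_ray fourier_coeff_P by simp
  qed
  have a: ?a if ?conv
  proof -
    interpret convergent_recurrence \<alpha> \<beta> \<phi> f g using that by unfold_locales
    have "\<exists>I. has_improper_integral (integrand1 \<alpha> \<beta> \<phi> g k) I 1 \<and>
           fourier_coeff (P_fun \<alpha> \<beta> \<phi> f g) k =
             1 / of_real (ln 2) * I +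
             of_real (f 1) / of_real (ln 2) * integral {0..1} (integrand2 \<alpha> \<beta> \<phi> k)" for k
      using has_improper_integral_integrand1[of k] fourier_coeff_P[of k] by (intro exI conjI) auto
    then show ?thesis
      using Q_term_sums extend_f_eq Q_fun_smallo int_summable_P_term continuous_on_P P_periodic
      by (intro conjI allI impI) (auto intro: sums_summable)
  qed
  \<comment> \<open>Besides the Fourier series, this extracts the hypothesis of (b) from that of
    (c); uniform convergence and the coefficient formula then come from \<open>b\<close>.\<close>
  have c: "?c \<and> ?d" and B_A: ?sumA if "\<alpha> + \<beta> > 1 \<and> ?sumB"
  proof -
    interpret smooth_recurrence \<alpha> \<beta> \<phi> f g using that by unfold_locales auto
    show ?sumA by (rule summable_A)
    have "character k t = exp (2 * of_real pi * \<i> * of_int k * of_real t)" for k t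
      by (simp add: character_def cis_conv_exp mult_ac)
    then show "?c \<and> ?d"
      using has_sum_fourier_P summable_coefficients_P by (simp add: fourier_coeff_eq)
  qed
  show ?thesis using a b c B_A by blast
qed

end
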